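(* Let $\alpha\in(0,1)$ and suppose $X_\infty$ has the Sibuya$(\alpha)$ distribution, that is $\Phi_\infty(z)=\mathbf{E}(z^{X_\infty})=1-(1-z)^\alpha$, with $\mathbf{P}(X_\infty=j)=\pi(j)=\alpha[1-\alpha]_{j-1}/j!$, $j\ge1$. Then: (i) The sequence $\pi(j)$, $j\ge1$, is completely monotone, so log-convex with decreasing failure rate, and $X_\infty-1$ is infinitely divisible. (ii) In distribution, $X_\infty=\inf\left(i\ge1:\mathcal{B}_i(\alpha_i)=1\right)$, where $(\mathcal{B}_i(\alpha_i))_{i\ge1}$ is a sequence of independent Bernoulli random variables with $\mathbf{P}(\mathcal{B}_i(\alpha_i)=1)=\alpha/i$. (iii) The solution $F(i)=\mathbf{P}(\nu\le i)$ to the functional equation $\mathbf{P}(X_\infty\le i)=\Phi_\infty(F(i))$, $i\ge1$, is $$\mathbf{P}(\nu\le i)=1-\left(1-\alpha\sum_{j=1}^{i}[1-\alpha]_{j-1}/j!\right)^{1/\alpha}.$$ (iv) Both $X_\infty$ and $\nu$ have algebraic (power-law) tails, with tail index $\alpha$ and $1$ respectively. (v) We have $$\mathbf{P}(\nu>i)\sim\frac{1}{\Gamma(1-\alpha)^{1/\alpha}}\,i^{-1}\quad\text{as } i\to\infty,$$ and $1/\Gamma(1-\alpha)^{1/\alpha}<e^{-\gamma}$. For all $\alpha\in(0,1)$, the Lamperti chain generated by $\nu$ is positive recurrent, with invariant probability measure $\mathbf{\pi}=(\pi(j))_{j\ge1}$.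
   Context: $[a]_k=a(a+1)\cdots(a+k-1)$ is the rising factorial ($[a]_0=1$), $\Gamma$ the Gamma function, $\gamma$ the Euler constant, and $\sim$ means that the ratio of the two sides tends to $1$. A sequence $a_j$ is completely monotone if $(-1)^k\Delta^{(k)}a_j\ge0$ for all $j$ and all $k\ge0$, where $\Delta a_j=a_{j+1}-a_j$. Decreasing failure rate means that $\mathbf{P}(X_\infty=j)/\mathbf{P}(X_\infty\ge j)$ is decreasing in $j$. A random variable $X$ has algebraic tails with index $a>0$ if $\mathbf{P}(X>j)\sim c\,j^{-a}$ as $j\to\infty$ for some constant $c>0$. The Lamperti chain generated by $\nu$ (a random variable on $\{1,2,\dots\}$ with distribution function $F$) is the Markov chain on $\{1,2,\dots\}$ given by $X_{n+1}=\max_{j=1,\dots,X_n}\nu_{j,n+1}$ with $\nu_{j,n+1}$ i.i.d. copies of $\nu$, i.e. with transition matrix $P(i,j)=F(j)^i-F(j-1)^i$, $F(0)=0$. *)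

theory Defs
  imports "HOL-Probability.Probability" "HOL-Library.Landau_Symbols"
begin

section \<open>The Sibuya weights and generating functions\<close>

text \<open>Only the values for \<open>j \<ge> 1\<close> are meaningful; the truncated subtraction makes the value at
  \<open>0\<close> irrelevant junk.\<close>

definition sibuya :: "real \<Rightarrow> nat \<Rightarrow> real" where
  "sibuya \<alpha> j = \<alpha> * pochhammer (1 - \<alpha>) (j - 1) / fact j"

definition pgf :: "'a measure \<Rightarrow> ('a \<Rightarrow> nat) \<Rightarrow> real \<Rightarrow> real" where
  "pgf M X z = (\<integral>\<omega>. z ^ X \<omega> \<partial>M)"

section \<open>Sequences and distributions\<close>

definition fwd_diff :: "(nat \<Rightarrow> real) \<Rightarrow> nat \<Rightarrow> real" where
  "fwd_diff a = (\<lambda>j. a (Suc j) - a j)"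

definition completely_monotone :: "(nat \<Rightarrow> real) \<Rightarrow> bool" where
  "completely_monotone a \<longleftrightarrow> (\<forall>k j. (-1) ^ k * (fwd_diff ^^ k) a j \<ge> 0)"

definition log_convex_seq :: "(nat \<Rightarrow> real) \<Rightarrow> bool" where
  "log_convex_seq a \<longleftrightarrow> (\<forall>j. a j > 0) \<and> (\<forall>j. (a (Suc j))\<^sup>2 \<le> a j * a (Suc (Suc j)))"

text \<open>The failure rate is considered on the support \<open>{1, 2, \<dots>}\<close>; as usual for this notion,
  ``decreasing'' is meant in the weak sense.\<close>

definition decreasing_failure_rate :: "'a measure \<Rightarrow> ('a \<Rightarrow> nat) \<Rightarrow> bool" where
  "decreasing_failure_rate M X \<longleftrightarrow>
     antimono_on {1..} (\<lambda>j. measure M {\<omega> \<in> space M. X \<omega> = j} / measure M {\<omega> \<in> space M. X \<omega> \<ge> j})"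

definition infinitely_divisible :: "real measure \<Rightarrow> bool" where
  "infinitely_divisible D \<longleftrightarrow>
     (\<forall>n::nat. n \<ge> 1 \<longrightarrow> (\<exists>N. real_distribution N \<and> D = distr (\<Pi>\<^sub>M i\<in>{..<n}. N) borel (\<lambda>x. \<Sum>i<n. x i)))"

definition algebraic_tails :: "'a measure \<Rightarrow> ('a \<Rightarrow> nat) \<Rightarrow> real \<Rightarrow> bool" where
  "algebraic_tails M X a \<longleftrightarrow>
     (\<exists>c>0. (\<lambda>j::nat. measure M {\<omega> \<in> space M. X \<omega> > j}) \<sim>[at_top] (\<lambda>j. c * real j powr (-a)))"

section \<open>Markov chains\<close>

text \<open>A chain is given by its transition kernel \<open>K\<close>; \<open>path_pmf K n i\<close> is the joint law of
  \<open>[X\<^sub>1, \<dots>, X\<^sub>n]\<close> when \<open>X\<^sub>0 = i\<close>.\<close>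

primrec path_pmf :: "('s \<Rightarrow> 's pmf) \<Rightarrow> nat \<Rightarrow> 's \<Rightarrow> 's list pmf" where
  "path_pmf K 0 i = return_pmf []"
| "path_pmf K (Suc n) i = bind_pmf (K i) (\<lambda>k. map_pmf ((#) k) (path_pmf K n k))"

text \<open>The probability that the first return to \<open>i\<close> takes place at time \<open>n + 1\<close>: the list entry with
  index \<open>m\<close> is \<open>X\<^bsub>m+1\<^esub>\<close>.\<close>

definition first_return_prob :: "('s \<Rightarrow> 's pmf) \<Rightarrow> 's \<Rightarrow> nat \<Rightarrow> real" where
  "first_return_prob K i n =
     measure_pmf.prob (path_pmf K (Suc n) i) {xs. xs ! n = i \<and> (\<forall>m<n. xs ! m \<noteq> i)}"

text \<open>Every state returns to itself almost surely, and the mean return time is finite.\<close>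

definition positive_recurrent :: "('s \<Rightarrow> 's pmf) \<Rightarrow> 's set \<Rightarrow> bool" where
  "positive_recurrent K S \<longleftrightarrow>
     (\<forall>i\<in>S. first_return_prob K i sums 1 \<and> summable (\<lambda>n. real (Suc n) * first_return_prob K i n))"

definition invariant_probability :: "('s \<Rightarrow> 's pmf) \<Rightarrow> 's set \<Rightarrow> ('s \<Rightarrow> real) \<Rightarrow> bool" where
  "invariant_probability K S p \<longleftrightarrow>
     (\<forall>i\<in>S. p i \<ge> 0) \<and> (p has_sum 1) S \<and>
     (\<forall>j\<in>S. ((\<lambda>i. p i * pmf (K i) j) has_sum p j) S)"

section \<open>The Lamperti chain\<close>

text \<open>The kernel of the chain that moves from \<open>i \<ge> 1\<close> to the maximum of \<open>i\<close> i.i.d. copies of \<open>\<nu>\<close>,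
  where the law \<open>\<nu>\<close> lives on \<open>{1, 2, \<dots>}\<close>. The value at \<open>i = 0\<close> (maximum of the empty set) is
  outside the state space.\<close>

definition lamperti_kernel :: "nat pmf \<Rightarrow> nat \<Rightarrow> nat pmf" where
  "lamperti_kernel \<nu> i = map_pmf (\<lambda>x. Max (x ` {1..i})) (Pi_pmf {1..i} 0 (\<lambda>_. \<nu>))"

definition cdf_nat :: "nat pmf \<Rightarrow> nat \<Rightarrow> real" where
  "cdf_nat \<nu> i = measure_pmf.prob \<nu> {..i}"

lemma lamperti_kernel_cdf:
  assumes "i \<ge> 1"
  shows "measure_pmf.prob (lamperti_kernel \<nu> i) {..j} = cdf_nat \<nu> j ^ i"
proof -
  have "(\<lambda>x::nat \<Rightarrow> nat. Max (x ` {1..i})) -` {..j} = Pi {1..i} (\<lambda>_. {..j})"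
    using assms by (auto simp: Pi_def)
  then have "measure_pmf.prob (lamperti_kernel \<nu> i) {..j} =
      measure_pmf.prob (Pi_pmf {1..i} 0 (\<lambda>_. \<nu>)) (Pi {1..i} (\<lambda>_. {..j}))"
    by (simp add: lamperti_kernel_def)
  also have "\<dots> = (\<Prod>x\<in>{1..i}. measure_pmf.prob \<nu> {..j})"
    by (rule measure_Pi_pmf_Pi) auto
  finally show ?thesis
    by (simp add: cdf_nat_def)
qed

text \<open>The transition matrix in closed form.\<close>

lemma pmf_lamperti_kernel:
  assumes "i \<ge> 1" "j \<ge> 1"
  shows "pmf (lamperti_kernel \<nu> i) j = cdf_nat \<nu> j ^ i - cdf_nat \<nu> (j - 1) ^ i"
proof -
  have eq: "{j} = {..j} - {..j - 1}"
    using assms by auto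
  have "pmf (lamperti_kernel \<nu> i) j = measure_pmf.prob (lamperti_kernel \<nu> i) ({..j} - {..j - 1})"
    by (metis eq measure_pmf_single)
  also have "\<dots> = measure_pmf.prob (lamperti_kernel \<nu> i) {..j} -
      measure_pmf.prob (lamperti_kernel \<nu> i) {..j - 1}"
    by (rule measure_pmf.finite_measure_Diff) auto
  finally show ?thesis
    using assms by (simp add: lamperti_kernel_cdf)
qed

text \<open>\<open>\<nu>\<close> is a law on \<open>{1, 2, \<dots>}\<close> whose distribution function \<open>F\<close> solves
  \<open>P (X \<le> i) = \<Phi> (F i)\<close> for all \<open>i \<ge> 1\<close>, where \<open>\<Phi>\<close> is the generating function of \<open>X\<close>.\<close>

definition lamperti_generator :: "'a measure \<Rightarrow> ('a \<Rightarrow> nat) \<Rightarrow> nat pmf \<Rightarrow> bool" where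
  "lamperti_generator M X \<nu> \<longleftrightarrow> set_pmf \<nu> \<subseteq> {1..} \<and>
     (\<forall>i\<ge>1. measure M {\<omega> \<in> space M. X \<omega> \<le> i} = pgf M X (cdf_nat \<nu> i))"

end

theory Submission
  imports Defs
begin

text \<open>
  Everything rests on \<open>P (X > n) = [1 - \<alpha>]\<^sub>n / n!\<close>, which telescopes to the weights, equals the product of
  the \<open>1 - \<alpha> / i\<close> for \<open>i \<le> n\<close>, and is asymptotic to \<open>n powr (-\<alpha>) / \<Gamma> (1 - \<alpha>)\<close> by Gauss' limit formula.
  The weights are a ratio \<open>[a]\<^sub>j / [b]\<^sub>j\<close> up to a constant, and a difference of such a ratio is a negative
  multiple of \<open>[a]\<^sub>j / [b + 1]\<^sub>j\<close>; this gives complete monotonicity. For infinite divisibility, log-convexity of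
  the coefficients of \<open>A\<close> makes those of \<open>A' / A\<close> nonnegative, and then \<open>n R' = (A' / A) R\<close> shows that the
  \<open>n\<close>-th root \<open>R\<close> of \<open>A\<close> has nonnegative coefficients as well. The constant in (v) is bounded by applying the
  mean value theorem to \<open>ln \<Gamma>\<close> on \<open>[1 - \<alpha>, 1]\<close>, since the digamma function increases to \<open>-\<gamma>\<close> at \<open>1\<close>.
  The functional equation for \<open>F\<close> says precisely that the law of \<open>X\<close> is stationary, and positive recurrence
  follows from the summation argument behind Kac's return time formula.
\<close>

unbundle fps_syntax and no vec_syntax

section \<open>Distributions on the natural numbers\<close>

lemma pmf_nat_eqI_atMost:
  fixes p q :: "nat pmf"
  assumes "\<And>i. measure_pmf.prob p {..i} = measure_pmf.prob q {..i}"
  shows "p = q"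
proof (rule pmf_eqI)
  fix i
  have *: "pmf r i = measure_pmf.prob r {..i} - (if i = 0 then 0 else measure_pmf.prob r {..i - 1})"
    for r :: "nat pmf"
  proof (cases i)
    case 0
    have "{..0::nat} = {0}" by auto
    with 0 show ?thesis by (simp add: measure_pmf_single)
  next
    case (Suc k)
    have "{i} = {..i} - {..k}" using Suc by auto
    then have "pmf r i = measure_pmf.prob r ({..i} - {..k})"
      by (metis measure_pmf_single)
    also have "\<dots> = measure_pmf.prob r {..i} - measure_pmf.prob r {..k}"
      using Suc by (intro measure_pmf.finite_measure_Diff) auto
    finally show ?thesis using Suc by simp
  qed
  show "pmf p i = pmf q i"
    unfolding * by (simp add: assms)
qed

text \<open>\<open>S n\<close> stands for P(Y \<ge> n) with Y starting at 0, so that Y + 1 exceeds n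
  with probability \<open>S n\<close>. Laws on {1, 2, ...} arise from it by
  \<open>map_pmf Suc\<close>.\<close>

definition pmf_of_survival :: "(nat \<Rightarrow> real) \<Rightarrow> nat pmf" where
  "pmf_of_survival S = embed_pmf (\<lambda>n. S n - S (Suc n))"

lemma pmf_of_survival:
  fixes S :: "nat \<Rightarrow> real"
  assumes anti: "\<And>n. S (Suc n) \<le> S n" and S0: "S 0 = 1" and lim: "S \<longlonglongrightarrow> 0"
  shows "pmf (pmf_of_survival S) n = S n - S (Suc n)"
    and "measure_pmf.prob (pmf_of_survival S) {..<n} = 1 - S n"
proof -
  define f where "f = (\<lambda>n. S n - S (Suc n))"
  have nn: "f n \<ge> 0" for n using anti[of n] by (simp add: f_def)
  have sums: "f sums 1"
    unfolding f_def using telescope_sums'[OF lim] S0 by simp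
  have "(\<integral>\<^sup>+x. ennreal (f x) \<partial>count_space UNIV) = 1"
    using sums nn by (simp add: nn_integral_count_space_nat suminf_ennreal_eq sums_iff)
  then have pmf: "pmf (pmf_of_survival S) n = f n" for n
    unfolding pmf_of_survival_def f_def[symmetric] by (intro pmf_embed_pmf nn)
  then show "pmf (pmf_of_survival S) n = S n - S (Suc n)" by (simp add: f_def)
  show "measure_pmf.prob (pmf_of_survival S) {..<n} = 1 - S n"
    unfolding measure_measure_pmf_finite[OF finite_lessThan] pmf
    by (simp add: f_def sum_lessThan_telescope' S0)
qed

text \<open>Values in a Banach space let this serve real generating functions and complex
  characteristic functions alike.\<close>

lemma sums_integral_pmf_nat:
  fixes p :: "nat pmf" and f :: "nat \<Rightarrow> 'b::{banach, second_countable_topology}"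
  assumes "\<And>n. norm (f n) \<le> B"
  shows "(\<lambda>n. pmf p n *\<^sub>R f n) sums measure_pmf.expectation p f"
proof -
  have "integrable (measure_pmf p) f"
    by (rule measure_pmf.integrable_const_bound[where B = B]) (use assms in auto)
  then have "integrable (count_space UNIV) (\<lambda>n. pmf p n *\<^sub>R f n)"
    by (simp add: measure_pmf_eq_density integrable_density)
  from sums_integral_count_space_nat[OF this] show ?thesis
    by (simp add: measure_pmf_eq_density integral_density)
qed

section \<open>The Sibuya distribution\<close>

definition sibuya_tail :: "real \<Rightarrow> nat \<Rightarrow> real" where
  "sibuya_tail \<alpha> n = pochhammer (1 - \<alpha>) n / fact n"

lemma sibuya_tail_0 [simp]: "sibuya_tail \<alpha> 0 = 1"
  by (simp add: sibuya_tail_def)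

lemma sibuya_tail_Suc: "sibuya_tail \<alpha> (Suc n) = (1 - \<alpha> / real (Suc n)) * sibuya_tail \<alpha> n"
  by (simp add: sibuya_tail_def pochhammer_rec' field_simps)

lemma sibuya_Suc_eq_tail: "sibuya \<alpha> (Suc n) = \<alpha> / real (Suc n) * sibuya_tail \<alpha> n"
  by (simp add: sibuya_def sibuya_tail_def)

lemma sibuya_tail_diff: "sibuya_tail \<alpha> n - sibuya_tail \<alpha> (Suc n) = sibuya \<alpha> (Suc n)"
  by (simp add: sibuya_tail_Suc sibuya_Suc_eq_tail algebra_simps)

lemma sum_sibuya: "(\<Sum>j=1..n. sibuya \<alpha> j) = 1 - sibuya_tail \<alpha> n"
  by (induction n) (simp_all add: sibuya_tail_diff [symmetric])

text \<open>The quotient of the two sides is \<Gamma>(1 - \<alpha>) divided by Gauss' approximation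
  \<open>Gamma_series\<close> times 1 + (1 - \<alpha>)/n. The latter factor tends to 1 and accounts
  for the n + 1, instead of n, factors of the rising factorial in
  \<open>Gamma_series\<close>.\<close>

lemma sibuya_tail_asymp:
  assumes "0 < \<alpha>" "\<alpha> < 1"
  shows "sibuya_tail \<alpha> \<sim>[at_top] (\<lambda>n. 1 / Gamma (1 - \<alpha>) * real n powr (-\<alpha>))"
proof -
  have pos: "Gamma (1 - \<alpha>) > 0" using assms by (intro Gamma_real_pos) auto
  have eq: "eventually (\<lambda>n. sibuya_tail \<alpha> n / (1 / Gamma (1 - \<alpha>) * real n powr (-\<alpha>)) =
      Gamma (1 - \<alpha>) / (Gamma_series (1 - \<alpha>) n * (1 + (1 - \<alpha>) / real n))) at_top"
    using eventually_gt_at_top[of 0]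
  proof eventually_elim
    case (elim n)
    have p: "pochhammer (1 - \<alpha>) n > 0" using assms by (intro pochhammer_pos) auto
    have 1: "exp ((1 - \<alpha>) * ln (real n)) = real n * real n powr (-\<alpha>)"
      using elim by (simp add: powr_def algebra_simps exp_diff exp_minus field_simps)
    have 2: "1 + (1 - \<alpha>) / real n = (1 - \<alpha> + real n) / real n"
      using elim by (simp add: field_simps)
    have *: "1 - \<alpha> + real n > 0" using assms by auto
    show ?case
      using elim p * pos unfolding Gamma_series_def 2 sibuya_tail_def
      by (simp add: 1 divide_simps pochhammer_rec')
  qed
  have lim: "(\<lambda>n. Gamma (1 - \<alpha>) / (Gamma_series (1 - \<alpha>) n * (1 + (1 - \<alpha>) / real n)))
      \<longlonglongrightarrow> Gamma (1 - \<alpha>) / (Gamma (1 - \<alpha>) * (1 + 0))"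
    using pos by (intro tendsto_intros lim_const_over_n) auto
  show ?thesis
    by (intro asymp_equivI') (subst tendsto_cong[OF eq], use lim pos in simp)
qed

lemma sibuya_tail_tendsto_0:
  assumes "0 < \<alpha>" "\<alpha> < 1"
  shows "sibuya_tail \<alpha> \<longlonglongrightarrow> 0"
proof -
  have "(\<lambda>n. 1 / Gamma (1 - \<alpha>) * real n powr (-\<alpha>)) \<longlonglongrightarrow> 1 / Gamma (1 - \<alpha>) * 0"
    by (intro tendsto_intros tendsto_neg_powr filterlim_real_sequentially) (use assms in auto)
  then show ?thesis
    using asymp_equiv_symI[OF sibuya_tail_asymp[OF assms]] tendsto_asymp_equiv_cong by fastforce
qed

section \<open>Positivity, total mass and generating function\<close>

lemma sibuya_tail_pos: "\<alpha> < 1 \<Longrightarrow> sibuya_tail \<alpha> n > 0"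
  by (simp add: sibuya_tail_def pochhammer_pos)

lemma sibuya_pos: "0 < \<alpha> \<Longrightarrow> \<alpha> < 1 \<Longrightarrow> sibuya \<alpha> n > 0"
  by (simp add: sibuya_def pochhammer_pos)

text \<open>Newton's series for (1 - z)^\<alpha>: its coefficients of index at least 1 are the
  negated weights.\<close>

lemma sibuya_sums_powr:
  fixes z :: real
  assumes "\<bar>z\<bar> < 1"
  shows "(\<lambda>n. sibuya \<alpha> (Suc n) * z ^ Suc n) sums (1 - (1 - z) powr \<alpha>)"
proof -
  have c: "(\<alpha> gchoose Suc n) * (-z) ^ Suc n = - (sibuya \<alpha> (Suc n) * z ^ Suc n)" for n
  proof -
    have "(\<alpha> gchoose Suc n) = (-1) ^ Suc n * (-\<alpha> * pochhammer (1 - \<alpha>) n) / fact (Suc n)"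
      unfolding gbinomial_pochhammer pochhammer_rec by (simp add: algebra_simps)
    also have "\<dots> * (-z) ^ Suc n = ((-1) ^ Suc n * (-1) ^ Suc n) * (- (sibuya \<alpha> (Suc n) * z ^ Suc n))"
      unfolding power_minus[of z] sibuya_def by simp
    also have "(-1) ^ Suc n * (-1) ^ Suc n = (1::real)"
      by (simp flip: power_mult_distrib)
    finally show ?thesis by simp
  qed
  have "(\<lambda>n. (\<alpha> gchoose n) * (-z) ^ n) sums (1 + (-z)) powr \<alpha>"
    using assms by (intro gen_binomial_real) auto
  then have "(\<lambda>n. (\<alpha> gchoose Suc n) * (-z) ^ Suc n) sums ((1 - z) powr \<alpha> - 1)"
    by (subst sums_Suc_iff) simp_all
  then show ?thesis
    unfolding c using sums_minus by fastforce
qed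

text \<open>The law of X - 1 rather than of X: it starts at 0, as power series and the claim on
  infinite divisibility require.\<close>

definition sibuya_pmf :: "real \<Rightarrow> nat pmf" where
  "sibuya_pmf \<alpha> = pmf_of_survival (sibuya_tail \<alpha>)"

lemma sibuya_tail_antimono: "0 < \<alpha> \<Longrightarrow> \<alpha> < 1 \<Longrightarrow> sibuya_tail \<alpha> (Suc n) \<le> sibuya_tail \<alpha> n"
  using sibuya_tail_diff[of \<alpha> n] sibuya_pos[of \<alpha> "Suc n"] by simp

lemma sibuya_pmf:
  assumes "0 < \<alpha>" "\<alpha> < 1"
  shows "pmf (sibuya_pmf \<alpha>) n = sibuya \<alpha> (Suc n)"
    and "measure_pmf.prob (sibuya_pmf \<alpha>) {..<n} = 1 - sibuya_tail \<alpha> n"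
  unfolding sibuya_pmf_def using pmf_of_survival[of "sibuya_tail \<alpha>" n]
  by (simp_all add: sibuya_tail_antimono sibuya_tail_tendsto_0 assms sibuya_tail_diff)

lemma sibuya_sums_1:
  assumes "0 < \<alpha>" "\<alpha> < 1"
  shows "(\<lambda>n. sibuya \<alpha> (Suc n)) sums 1"
  using telescope_sums'[OF sibuya_tail_tendsto_0[OF assms]] by (simp add: sibuya_tail_diff)

text \<open>The binomial series settles the open interval. Dominated convergence makes the
  expectation continuous on [-1, 1], so the formula extends to both endpoints.\<close>

lemma pgf_sibuya_pmf:
  fixes z :: real
  assumes al: "0 < \<alpha>" "\<alpha> < 1" and z: "\<bar>z\<bar> \<le> 1"
  shows "pgf (measure_pmf (sibuya_pmf \<alpha>)) Suc z = 1 - (1 - z) powr \<alpha>"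
proof -
  define q where "q = sibuya_pmf \<alpha>"
  note q = sibuya_pmf(1)[OF al, folded q_def]
  define G where "G = (\<lambda>z::real. measure_pmf.expectation q (\<lambda>n. z ^ Suc n))"
  have inside: "G z = 1 - (1 - z) powr \<alpha>" if "\<bar>z\<bar> < 1" for z
  proof -
    have "(\<lambda>n. pmf q n *\<^sub>R z ^ Suc n) sums G z"
      unfolding G_def by (rule sums_integral_pmf_nat[where B = 1])
        (use that in \<open>simp add: power_abs abs_mult mult_le_one power_le_one\<close>)
    with sibuya_sums_powr[OF that, of \<alpha>] show ?thesis
      unfolding q by (simp add: sums_iff)
  qed
  have cont: "continuous_on {-1..1} G"
    unfolding G_def
  proof (rule continuous_on_sequentiallyI)
    fix u :: "nat \<Rightarrow> real" and a
    assume u: "\<forall>n. u n \<in> {-1..1}" and a: "a \<in> {-1..1}" "u \<longlonglongrightarrow> a"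
    show "(\<lambda>n. measure_pmf.expectation q (\<lambda>k. u n ^ Suc k)) \<longlonglongrightarrow> measure_pmf.expectation q (\<lambda>k. a ^ Suc k)"
    proof (rule integral_dominated_convergence[where w = "\<lambda>_. 1"])
      show "AE k in measure_pmf q. (\<lambda>n. u n ^ Suc k) \<longlonglongrightarrow> a ^ Suc k"
        using a by (intro AE_I2 tendsto_intros)
      have "\<bar>u n\<bar> \<le> 1" for n using u[rule_format, of n] by auto
      then show "AE k in measure_pmf q. norm (u n ^ Suc k) \<le> 1" for n
        by (simp add: power_abs abs_mult mult_le_one power_le_one)
    qed auto
  qed
  \<comment> \<open>At z = 1 the base vanishes, and continuity there rests on \<alpha> > 0.\<close>
  have cont': "continuous_on {-1..1} (\<lambda>z. 1 - (1 - z) powr \<alpha>)"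
    using al by (intro continuous_intros continuous_on_powr') auto
  have cl: "closure {-1<..<1::real} = {-1..1}" by simp
  have "G z - (1 - (1 - z) powr \<alpha>) = 0"
  proof (rule continuous_constant_on_closure[of "{-1<..<1}" "\<lambda>z. G z - (1 - (1 - z) powr \<alpha>)"])
    show "continuous_on (closure {-1<..<1}) (\<lambda>z. G z - (1 - (1 - z) powr \<alpha>))"
      unfolding cl by (intro continuous_on_diff cont cont')
  qed (use z cl inside in auto)
  then show ?thesis
    by (simp add: G_def pgf_def q_def)
qed

section \<open>Complete monotonicity and log-convexity of the weights\<close>

lemma fwd_diff_pow_cmult: "(fwd_diff ^^ k) (\<lambda>j. c * f j) = (\<lambda>j. c * (fwd_diff ^^ k) f j)"
  by (induction k) (simp_all add: fwd_diff_def algebra_simps)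

lemma fwd_diff_pochhammer_ratio:
  fixes a b :: real
  assumes "b > 0"
  shows "fwd_diff (\<lambda>j. pochhammer a j / pochhammer b j) =
    (\<lambda>j. - ((b - a) / b) * (pochhammer a j / pochhammer (b + 1) j))"
proof
  fix j
  have pos: "pochhammer b j > 0" "pochhammer (b + 1) j > 0" "b + real j > 0"
    using assms by (auto intro!: pochhammer_pos)
  \<comment> \<open>Both sides are \<open>pochhammer b (Suc j)\<close>, with the last or the first
    factor split off.\<close>
  have eq: "(b + real j) * pochhammer b j = b * pochhammer (b + 1) j"
    using pochhammer_rec[of b j] pochhammer_rec'[of b j] by simp
  have "fwd_diff (\<lambda>j. pochhammer a j / pochhammer b j) j =
      pochhammer a j * ((a + real j) / ((b + real j) * pochhammer b j) - 1 / pochhammer b j)"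
    by (simp add: fwd_diff_def pochhammer_rec' algebra_simps)
  also have "(a + real j) / ((b + real j) * pochhammer b j) - 1 / pochhammer b j =
      - (b - a) / ((b + real j) * pochhammer b j)"
    using pos by (simp add: divide_simps)
  also have "\<dots> = - (b - a) / (b * pochhammer (b + 1) j)"
    by (simp only: eq)
  finally show "fwd_diff (\<lambda>j. pochhammer a j / pochhammer b j) j =
      - ((b - a) / b) * (pochhammer a j / pochhammer (b + 1) j)"
    using assms pos by (simp add: divide_simps) (simp add: algebra_simps)
qed

text \<open>Induction on k for general b: each difference replaces b by b + 1 and contributes -(b -
  a)/b, whose sign is absorbed by (-1)^k because a \<le> b persists.\<close>

lemma completely_monotone_pochhammer_ratio:
  fixes a b :: real
  assumes "0 \<le> a" "a \<le> b" "0 < b"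
  shows "completely_monotone (\<lambda>j. pochhammer a j / pochhammer b j)"
proof -
  have "(-1) ^ k * (fwd_diff ^^ k) (\<lambda>j. pochhammer a j / pochhammer b j) j \<ge> 0" for k j
    using assms(2,3)
  proof (induction k arbitrary: b)
    case 0
    have "pochhammer a j \<ge> 0" "pochhammer b j > 0"
      using assms(1) 0 by (auto simp: pochhammer_prod intro!: prod_nonneg prod_pos)
    then show ?case by simp
  next
    case (Suc k)
    have "(fwd_diff ^^ Suc k) (\<lambda>j. pochhammer a j / pochhammer b j) j =
        - ((b - a) / b) * (fwd_diff ^^ k) (\<lambda>j. pochhammer a j / pochhammer (b + 1) j) j"
      unfolding funpow_Suc_right comp_def fwd_diff_pochhammer_ratio[OF Suc.prems(2)]
        fwd_diff_pow_cmult ..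
    then have "(-1) ^ Suc k * (fwd_diff ^^ Suc k) (\<lambda>j. pochhammer a j / pochhammer b j) j =
        (b - a) / b * ((-1) ^ k * (fwd_diff ^^ k) (\<lambda>j. pochhammer a j / pochhammer (b + 1) j) j)"
      by (simp add: mult_ac)
    also have "\<dots> \<ge> 0"
      using Suc.prems by (intro mult_nonneg_nonneg Suc.IH divide_nonneg_pos) auto
    finally show ?case .
  qed
  then show ?thesis by (simp add: completely_monotone_def)
qed

lemma completely_monotone_cmult:
  assumes "c \<ge> 0" "completely_monotone f"
  shows "completely_monotone (\<lambda>j. c * f j)"
proof -
  have "(-1) ^ k * (c * (fwd_diff ^^ k) f j) = c * ((-1) ^ k * (fwd_diff ^^ k) f j)" for k j
    by simp
  then show ?thesis
    using assms unfolding completely_monotone_def fwd_diff_pow_cmult by (simp only: mult_nonneg_nonneg simp_thms)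
qed

lemma completely_monotone_sibuya:
  assumes "0 < \<alpha>" "\<alpha> < 1"
  shows "completely_monotone (\<lambda>j. sibuya \<alpha> (Suc j))"
proof -
  \<comment> \<open>The factorial of j + 1 is \<open>pochhammer 2 j\<close>, so the parameters are a
    = 1 - \<alpha> and b = 2.\<close>
  have "sibuya \<alpha> (Suc j) = \<alpha> * (pochhammer (1 - \<alpha>) j / pochhammer 2 j)" for j
    using pochhammer_rec[of "1::real" j] by (simp add: sibuya_def pochhammer_fact)
  then show ?thesis
    using assms completely_monotone_cmult[OF _ completely_monotone_pochhammer_ratio, of \<alpha> "1 - \<alpha>" 2]
    by simp
qed

text \<open>The quotient of consecutive weights is (j + 1 - \<alpha>)/(j + 2), which increases in j
  because 1 - \<alpha> < 2.\<close>

lemma log_convex_sibuya: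
  assumes "0 < \<alpha>" "\<alpha> < 1"
  shows "log_convex_seq (\<lambda>j. sibuya \<alpha> (Suc j))"
proof -
  define s where "s = (\<lambda>j. sibuya \<alpha> (Suc j))"
  have pos: "s j > 0" for j using assms by (simp add: s_def sibuya_def pochhammer_pos)
  have rec: "s (Suc j) = (1 - \<alpha> + real j) / (real j + 2) * s j" for j
    by (simp add: s_def sibuya_def pochhammer_rec' field_simps)
  have "(s (Suc j))\<^sup>2 \<le> s j * s (Suc (Suc j))" for j
  proof -
    have "(1 - \<alpha> + real j) / (real j + 2) \<le> (1 - \<alpha> + real (Suc j)) / (real (Suc j) + 2)"
      using assms by (simp add: divide_simps) (simp add: algebra_simps)
    then have "s (Suc j) * ((1 - \<alpha> + real j) / (real j + 2) * s j)
        \<le> s (Suc j) * ((1 - \<alpha> + real (Suc j)) / (real (Suc j) + 2) * s j)"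
      using pos by (intro mult_left_mono mult_right_mono) (auto simp: less_imp_le)
    then show ?thesis
      using rec[of j] rec[of "Suc j"] by (simp add: power2_eq_square mult_ac)
  qed
  then show ?thesis using pos by (simp add: log_convex_seq_def s_def)
qed

text \<open>After taking logarithms the left side is the slope of ln \<Gamma> between 1 - \<alpha>
  and 1, since ln \<Gamma> vanishes at 1.\<close>

lemma Gamma_powr_bound:
  fixes \<alpha> :: real
  assumes "0 < \<alpha>" "\<alpha> < 1"
  shows "1 / Gamma (1 - \<alpha>) powr (1 / \<alpha>) < exp (- euler_mascheroni)"
proof -
  have "\<exists>z. 1 - \<alpha> < z \<and> z < 1 \<and> ln_Gamma 1 - ln_Gamma (1 - \<alpha>) = (1 - (1 - \<alpha>)) * Digamma z"
    using assms by (intro MVT2) (auto intro!: derivative_eq_intros)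
  then obtain z where z: "1 - \<alpha> < z" "z < 1" "- ln_Gamma (1 - \<alpha>) = \<alpha> * Digamma z"
    by (auto simp: ln_Gamma_real_pos)
  have "Digamma z < Digamma 1" using z assms by (intro Digamma_real_strict_mono) auto
  then have "(1 / \<alpha>) * (- ln_Gamma (1 - \<alpha>)) < - euler_mascheroni"
    unfolding z(3) using assms by simp
  moreover have "Gamma (1 - \<alpha>) \<noteq> 0"
    using Gamma_real_pos[of "1 - \<alpha>"] assms by (intro less_imp_neq[symmetric]) auto
  then have "1 / Gamma (1 - \<alpha>) powr (1 / \<alpha>) = exp ((1 / \<alpha>) * (- ln_Gamma (1 - \<alpha>)))"
    using assms by (simp add: ln_Gamma_real_pos powr_def exp_minus field_simps)
  ultimately show ?thesis by simp
qed

text \<open>P(\<nu> > n) will be this power of the tail of X; the exponents -\<alpha> and 1/\<alpha>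
  multiply to -1.\<close>

lemma sibuya_tail_powr_asymp:
  assumes "0 < \<alpha>" "\<alpha> < 1"
  shows "(\<lambda>n. sibuya_tail \<alpha> n powr (1 / \<alpha>)) \<sim>[at_top]
    (\<lambda>n. 1 / Gamma (1 - \<alpha>) powr (1 / \<alpha>) * inverse (real n))"
proof -
  have pos: "Gamma (1 - \<alpha>) > 0" using assms by (intro Gamma_real_pos) auto
  have "(\<lambda>n. sibuya_tail \<alpha> n powr (1 / \<alpha>)) \<sim>[at_top]
      (\<lambda>n. (1 / Gamma (1 - \<alpha>) * real n powr (-\<alpha>)) powr (1 / \<alpha>))"
    using sibuya_tail_pos[of \<alpha>] assms pos
    by (intro asymp_equiv_powr_real sibuya_tail_asymp) (auto intro!: always_eventually simp: less_imp_le)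
  also have "(\<lambda>n. (1 / Gamma (1 - \<alpha>) * real n powr (-\<alpha>)) powr (1 / \<alpha>)) =
      (\<lambda>n. 1 / Gamma (1 - \<alpha>) powr (1 / \<alpha>) * inverse (real n))"
    using pos assms by (intro ext) (simp add: powr_mult powr_divide powr_powr powr_neg_one' powr_minus_divide field_simps)
  finally show ?thesis .
qed

section \<open>Infinite divisibility of log-convex distributions\<close>

text \<open>The quotients \<open>a (Suc j) / a j\<close> increase; comparing them at m and n and
  clearing denominators gives this form.\<close>

lemma log_convex_seq_cross:
  assumes "log_convex_seq a" "m \<le> n"
  shows "a (Suc m) * a n \<le> a m * a (Suc n)"
proof -
  have pos: "a j > 0" for j using assms(1) by (simp add: log_convex_seq_def)
  have "mono (\<lambda>j. a (Suc j) / a j)"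
  proof (rule incseq_SucI)
    fix j
    have "(a (Suc j))\<^sup>2 \<le> a j * a (Suc (Suc j))" using assms(1) by (simp add: log_convex_seq_def)
    then show "a (Suc j) / a j \<le> a (Suc (Suc j)) / a (Suc j)"
      using pos by (simp add: divide_simps power2_eq_square mult_ac)
  qed
  from monoD[OF this assms(2)] show ?thesis
    using pos by (simp add: divide_simps mult_ac)
qed

text \<open>Kaluza's argument: after multiplication by \<open>a m\<close>, the coefficient \<open>m + 1\<close> of the reciprocal is a
  combination of the earlier ones whose weights are nonnegative by log-convexity; the term with index
  \<open>0\<close>, the only positive one, drops out.\<close>

lemma inverse_fps_nth_nonpos:
  fixes a :: "nat \<Rightarrow> real"
  assumes lc: "log_convex_seq a"
  shows "n > 0 \<Longrightarrow> inverse (Abs_fps a) $ n \<le> 0"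
proof (induction n rule: less_induct)
  case (less n)
  have pos: "a j > 0" for j using lc by (simp add: log_convex_seq_def)
  define b where "b = fps_nth (inverse (Abs_fps a))"
  have prod: "(\<Sum>i=0..m. a (m - i) * b i) = (if m = 0 then 1 else 0)" for m
  proof -
    have "inverse (Abs_fps a) * Abs_fps a = 1"
      using pos[of 0] by (intro inverse_mult_eq_1) auto
    then have "(inverse (Abs_fps a) * Abs_fps a) $ m = (if m = 0 then 1 else 0)" by simp
    then show ?thesis
      unfolding fps_mult_nth b_def by (simp add: mult.commute)
  qed
  have b0: "b 0 > 0" using prod[of 0] pos[of 0] zero_less_mult_pos[of "a 0" "b 0"] by simp
  obtain m where n: "n = Suc m" using less.prems by (cases n) auto
  show ?case
  proof (cases m)
    case 0
    have "a 1 * b 0 + a 0 * b 1 = 0" using prod[of 1] by simp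
    then have "a 0 * b 1 \<le> 0" using pos[of 1] b0 by (simp add: add_eq_0_iff)
    then show ?thesis using pos[of 0] 0 n by (simp add: b_def mult_le_0_iff)
  next
    case (Suc k)
    have "a (Suc m) * (\<Sum>i=0..m. a (m - i) * b i) = 0" using prod[of m] Suc by simp
    moreover have "a m * (\<Sum>i=0..Suc m. a (Suc m - i) * b i) = 0" using prod[of "Suc m"] by simp
    ultimately have "a m * (a 0 * b (Suc m)) =
        (\<Sum>i=0..m. (a (Suc m) * a (m - i) - a m * a (Suc m - i)) * b i)"
      by (simp add: algebra_simps sum_subtractf sum_distrib_left)
    also have "\<dots> \<le> 0"
    proof (intro sum_nonpos)
      fix i assume i: "i \<in> {0..m}"
      show "(a (Suc m) * a (m - i) - a m * a (Suc m - i)) * b i \<le> 0"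
      proof (cases "i = 0")
        case False
        have "a (Suc (m - i)) * a m \<le> a (m - i) * a (Suc m)"
          by (rule log_convex_seq_cross[OF lc]) simp
        moreover have "Suc m - i = Suc (m - i)" using i by auto
        moreover have "b i \<le> 0" using less.IH[of i] False i n by (simp add: b_def)
        ultimately show ?thesis by (intro mult_nonneg_nonpos) (simp_all add: mult.commute)
      qed (simp add: mult.commute)
    qed
    finally have "a m * (a 0 * b (Suc m)) \<le> 0" .
    then show ?thesis using pos[of 0] pos[of m] n by (simp add: b_def mult_le_0_iff)
  qed
qed

text \<open>A'/A equals -(1/A)' A, and the derivative only sees the coefficients of 1/A of positive
  index, which are nonpositive by Kaluza.\<close>

lemma log_convex_fps_log_deriv_nonneg:
  fixes a :: "nat \<Rightarrow> real"
  assumes lc: "log_convex_seq a"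
  shows "(fps_deriv (Abs_fps a) * inverse (Abs_fps a)) $ n \<ge> 0"
proof -
  let ?A = "Abs_fps a"
  have pos: "a j > 0" for j using lc by (simp add: log_convex_seq_def)
  have A0: "?A $ 0 \<noteq> 0" using pos[of 0] by simp
  have "fps_deriv ?A * inverse ?A = - fps_deriv (inverse ?A) * ?A"
  proof -
    have "fps_deriv (inverse ?A) = - fps_deriv ?A * (inverse ?A)\<^sup>2"
      by (rule fps_inverse_deriv[OF A0])
    moreover have "inverse ?A * ?A = 1" by (rule inverse_mult_eq_1[OF A0])
    ultimately show ?thesis by (simp add: power2_eq_square mult.assoc)
  qed
  also have "\<dots> $ n = (\<Sum>i=0..n. - (real (Suc i) * inverse ?A $ Suc i) * a (n - i))"
    by (simp only: fps_mult_nth fps_neg_nth fps_deriv_nth fps_nth_Abs_fps Suc_eq_plus1)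
  also have "\<dots> \<ge> 0"
    using pos inverse_fps_nth_nonpos[OF lc] by (intro sum_nonneg mult_nonneg_nonneg) (auto simp: less_imp_le mult_nonneg_nonpos)
  finally show ?thesis .
qed

text \<open>In n R' = (A'/A) R, the coefficient of index j expresses \<open>R $ Suc j\<close>
  through earlier coefficients of R with nonnegative weights, starting from the positive root of
  \<open>A $ 0\<close>.\<close>

lemma fps_root_nonneg:
  fixes A :: "real fps"
  assumes A0: "A $ 0 > 0" and C: "\<And>k. (fps_deriv A * inverse A) $ k \<ge> 0" and n: "n > 0"
  obtains R where "R ^ n = A" "\<And>k. R $ k \<ge> 0" "R $ 0 > 0"
proof -
  obtain m where m: "n = Suc m" using n by (cases n) auto
  define R where "R = fps_radical root n A"
  have R: "R ^ n = A"
    unfolding R_def m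
    by (subst power_radical[symmetric]) (use A0 in \<open>auto simp del: power_Suc\<close>)
  have R0: "R $ 0 = root n (A $ 0)" by (simp add: R_def m)
  have R0pos: "R $ 0 > 0" using A0 n by (simp add: R0)
  define C where "C = fps_deriv A * inverse A"
  have CA: "C * A = fps_deriv A"
    unfolding C_def using inverse_mult_eq_1[of A] A0 by (simp add: mult.assoc)
  \<comment> \<open>Differentiate R^n = A and replace A' by C R^n; the common power of R is then
    cancelled.\<close>
  have "of_nat n * fps_deriv R * R ^ m * R = C * R * R ^ m * R"
  proof -
    have "of_nat n * fps_deriv R * R ^ m = fps_deriv A"
      unfolding R[symmetric] fps_deriv_power' by (simp add: m)
    also have "\<dots> = C * R ^ n" by (simp add: CA R)
    finally show ?thesis by (simp add: m algebra_simps)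
  qed
  moreover have "R \<noteq> 0" using R0pos by auto
  ultimately have ode: "of_nat n * fps_deriv R = C * R" by simp
  have "R $ k \<ge> 0" for k
  proof (induction k rule: less_induct)
    case (less k)
    show ?case
    proof (cases k)
      case 0
      then show ?thesis using R0pos by simp
    next
      case (Suc j)
      have "(of_nat n * fps_deriv R) $ j = (C * R) $ j" by (simp only: ode)
      then have "real n * (real (Suc j) * R $ Suc j) = (\<Sum>i=0..j. C $ i * R $ (j - i))"
        unfolding fps_mult_of_nat_nth fps_deriv_nth fps_mult_nth[of C] by simp
      also have "\<dots> \<ge> 0"
        using C Suc by (intro sum_nonneg mult_nonneg_nonneg less.IH) (auto simp: C_def)
      finally show ?thesis using n Suc by (simp add: zero_le_mult_iff del: of_nat_Suc)
    qed
  qed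
  with that R R0pos show ?thesis by blast
qed

text \<open>Keeps one term of the expansion, with the constant coefficient taken from n of the n + 1
  factors. This transfers summability from a power to its root.\<close>

lemma fps_power_nth_ge:
  fixes R :: "real fps"
  assumes nn: "\<And>k. R $ k \<ge> 0"
  shows "(R ^ Suc n) $ k \<ge> (R $ 0) ^ n * R $ k"
proof -
  have *: "(R ^ n) $ k \<ge> 0" for n k
    by (induction n arbitrary: k) (auto simp: fps_mult_nth nn intro!: sum_nonneg mult_nonneg_nonneg)
  show "(R ^ Suc n) $ k \<ge> (R $ 0) ^ n * R $ k"
  proof (induction n)
    case (Suc n)
    have "(R $ 0) ^ Suc n * R $ k \<le> R $ 0 * (R ^ Suc n) $ k"
      using mult_left_mono[OF Suc nn[of 0]] by (simp add: mult_ac)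
    also have "\<dots> = (\<Sum>i\<in>{0}. R $ i * (R ^ Suc n) $ (k - i))" by simp
    also have "\<dots> \<le> (\<Sum>i=0..k. R $ i * (R ^ Suc n) $ (k - i))"
      by (intro sum_mono2 mult_nonneg_nonneg nn *) auto
    also have "\<dots> = (R ^ Suc (Suc n)) $ k" by (simp add: fps_mult_nth)
    finally show ?case .
  qed simp
qed

text \<open>Absolute summability makes Cauchy products converge on the closed disc, boundary
  included. The cases needed are w = 1 for the total mass and w = exp(it) for characteristic
  functions.\<close>

lemma sums_fps_power:
  fixes R :: "real fps" and w :: complex
  assumes sm: "summable (\<lambda>k. norm (R $ k))" and w: "norm w \<le> 1"
  shows "summable (\<lambda>k. norm ((R ^ n) $ k))"
    and "(\<lambda>k. of_real ((R ^ n) $ k) * w ^ k) sums (\<Sum>k. of_real (R $ k) * w ^ k) ^ n"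
proof -
  have wle: "norm (of_real x * w ^ k) \<le> norm x" for x k
    using mult_left_mono[of "norm w ^ k" 1 "\<bar>x\<bar>"] w by (simp add: norm_mult norm_power power_le_one)
  have smR: "summable (\<lambda>k. norm (complex_of_real (R $ k) * w ^ k))"
    by (rule summable_comparison_test'[OF sm, of 0]) (use wle in simp)
  have "summable (\<lambda>k. norm ((R ^ n) $ k)) \<and>
    (\<lambda>k. of_real ((R ^ n) $ k) * w ^ k) sums (\<Sum>k. of_real (R $ k) * w ^ k) ^ n"
  proof (induction n)
    case 0
    have "(\<lambda>k. of_real ((R ^ 0) $ k) * w ^ k) = (\<lambda>k. if k = 0 then 1 else 0)"
      "(\<lambda>k. norm ((R ^ 0) $ k)) = (\<lambda>k. if k = 0 then 1 else 0)" by auto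
    then show ?case using sums_single[of 0 "\<lambda>_. 1::complex"] sums_single[of 0 "\<lambda>_. 1::real"]
      by (auto simp: sums_iff)
  next
    case (Suc n)
    then have smn: "summable (\<lambda>k. norm ((R ^ n) $ k))"
      and sn: "(\<lambda>k. of_real ((R ^ n) $ k) * w ^ k) sums (\<Sum>k. of_real (R $ k) * w ^ k) ^ n" by auto
    have smn': "summable (\<lambda>k. norm (complex_of_real ((R ^ n) $ k) * w ^ k))"
      by (rule summable_comparison_test'[OF smn, of 0]) (use wle in simp)
    have "summable (\<lambda>k. norm ((R ^ Suc n) $ k))"
    proof (rule summable_comparison_test')
      show "summable (\<lambda>k. \<Sum>i\<le>k. norm (R $ i) * norm ((R ^ n) $ (k - i)))"
        using sm smn by (intro summable_Cauchy_product) auto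
      show "norm (norm ((R ^ Suc n) $ k)) \<le> (\<Sum>i\<le>k. norm (R $ i) * norm ((R ^ n) $ (k - i)))" for k
        using norm_sum[of "\<lambda>i. R $ i * (R ^ n) $ (k - i)" "{..k}"]
        by (simp add: fps_mult_nth atLeast0AtMost abs_mult)
    qed
    moreover have "(\<lambda>k. \<Sum>i\<le>k. (of_real (R $ i) * w ^ i) * (of_real ((R ^ n) $ (k - i)) * w ^ (k - i))) sums
        ((\<Sum>k. of_real (R $ k) * w ^ k) * (\<Sum>k. of_real ((R ^ n) $ k) * w ^ k))"
      by (rule Cauchy_product_sums[OF smR smn'])
    moreover have "(\<Sum>i\<le>k. (of_real (R $ i) * w ^ i) * (of_real ((R ^ n) $ (k - i)) * w ^ (k - i))) =
        of_real ((R ^ Suc n) $ k) * w ^ k" for k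
    proof -
      have "(of_real (R $ i) * w ^ i) * (of_real ((R ^ n) $ (k - i)) * w ^ (k - i)) =
          of_real (R $ i * (R ^ n) $ (k - i)) * w ^ k" if "i \<le> k" for i
        using that by (simp add: power_add[symmetric] mult_ac)
      then show ?thesis
        unfolding power_Suc fps_mult_nth atLeast0AtMost of_real_sum sum_distrib_right
        by (intro sum.cong refl) (simp only: atMost_iff)
    qed
    moreover have "(\<Sum>k. of_real ((R ^ n) $ k) * w ^ k) = (\<Sum>k. of_real (R $ k) * w ^ k) ^ n"
      using sn by (simp add: sums_iff)
    ultimately show ?case by simp
  qed
  then show "summable (\<lambda>k. norm ((R ^ n) $ k))"
    and "(\<lambda>k. of_real ((R ^ n) $ k) * w ^ k) sums (\<Sum>k. of_real (R $ k) * w ^ k) ^ n" by auto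
qed

section \<open>Characteristic functions and convolution roots\<close>

lemma char_distr_pmf_nat:
  fixes q :: "nat pmf"
  shows "(\<lambda>k. of_real (pmf q k) * iexp t ^ k) sums char (distr (measure_pmf q) borel real) t"
proof -
  have "(\<lambda>k. pmf q k *\<^sub>R iexp (t * real k)) sums measure_pmf.expectation q (\<lambda>k. iexp (t * real k))"
    by (rule sums_integral_pmf_nat[where B = 1]) simp
  moreover have "iexp (t * real k) = iexp t ^ k" for k
    by (simp add: exp_of_nat_mult[symmetric] mult_ac)
  ultimately show ?thesis
    by (simp add: char_def integral_distr scaleR_conv_of_real)
qed

text \<open>The generating function has an n-th root with nonnegative coefficients. They sum to 1,
  hence form a law, and the sum of n independent copies has the right characteristic
  function.\<close>

lemma infinitely_divisible_log_convex:
  fixes q :: "nat pmf"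
  assumes lc: "log_convex_seq (pmf q)"
  shows "infinitely_divisible (distr (measure_pmf q) borel real)"
  unfolding infinitely_divisible_def
proof (intro allI impI)
  fix n :: nat assume n: "1 \<le> n"
  define A where "A = Abs_fps (pmf q)"
  have "A $ 0 > 0" using lc by (simp add: A_def log_convex_seq_def)
  moreover have "(fps_deriv A * inverse A) $ k \<ge> 0" for k
    unfolding A_def by (rule log_convex_fps_log_deriv_nonneg[OF lc])
  ultimately obtain R where R: "R ^ n = A" "\<And>k. R $ k \<ge> 0" "R $ 0 > 0"
    using fps_root_nonneg[of A n] n by auto
  have sumA: "pmf q sums 1"
    using sums_integral_pmf_nat[of "\<lambda>_. 1::real" 1 q] by simp
  \<comment> \<open>Each coefficient of R is at most that of R^n = A divided by the constant (R $
    0)^(n - 1).\<close>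
  have summable_R: "summable (fps_nth R)"
  proof (rule summable_comparison_test')
    show "summable (\<lambda>k. pmf q k / (R $ 0) ^ (n - 1))"
      using sumA by (intro summable_divide) (auto simp: sums_iff)
    have "(R $ 0) ^ (n - 1) * R $ k \<le> pmf q k" for k
      using fps_power_nth_ge[of R "n - 1" k] R n by (simp add: A_def del: power_Suc)
    then show "norm (R $ k) \<le> pmf q k / (R $ 0) ^ (n - 1)" for k
      using R by (simp add: field_simps)
  qed
  then have norm_R: "summable (\<lambda>k. norm (R $ k))" using R by simp
  define s where "s = suminf (fps_nth R)"
  have "s > 0" unfolding s_def using suminf_pos2[OF summable_R R(2), of 0] R by simp
  \<comment> \<open>Evaluation at w = 1: s^n is the total mass of \<open>q\<close>, so the positive
    number s is 1.\<close>
  have "(\<Sum>k. complex_of_real (R $ k) * 1 ^ k) = complex_of_real s"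
    using suminf_of_real[OF summable_R, where 'a = complex] by (simp add: s_def)
  with sums_fps_power(2)[OF norm_R, of 1 n] have "(\<lambda>k. complex_of_real (pmf q k)) sums (complex_of_real s) ^ n"
    by (simp add: R A_def)
  moreover have "(\<lambda>k. complex_of_real (pmf q k)) sums complex_of_real 1"
    using sumA by (rule sums_of_real)
  ultimately have "complex_of_real (s ^ n) = complex_of_real 1"
    using sums_unique2 by fastforce
  then have "s ^ n = 1" by (simp only: of_real_eq_iff)
  then have "s = 1" using \<open>s > 0\<close> n power_eq_imp_eq_base[of s n 1] by simp
  then have R_sums: "fps_nth R sums 1" using summable_R by (simp add: s_def sums_iff)
  define r where "r = embed_pmf (fps_nth R)"
  have "(\<integral>\<^sup>+x. ennreal (R $ x) \<partial>count_space UNIV) = 1"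
    using R_sums R by (simp add: nn_integral_count_space_nat suminf_ennreal_eq sums_iff)
  then have r: "pmf r k = R $ k" for k
    unfolding r_def by (intro pmf_embed_pmf R)
  define N where "N = distr (measure_pmf r) borel real"
  have N: "real_distribution N"
    unfolding N_def by (intro prob_space.real_distribution_distr measure_pmf.prob_space_axioms) simp
  interpret N: real_distribution N by (rule N)
  interpret P: prob_space "Pi\<^sub>M {..<n} (\<lambda>_. N)"
    by (intro prob_space_PiM N.prob_space_axioms)
  have rv: "(\<lambda>x. x i) \<in> borel_measurable (Pi\<^sub>M {..<n} (\<lambda>_. N))" if "i < n" for i
    using that measurable_component_singleton[of i "{..<n}" "\<lambda>_. N"] by (simp cong: measurable_cong_sets)
  have component: "distr (Pi\<^sub>M {..<n} (\<lambda>_. N)) borel (\<lambda>x. x i) = N" if "i < n" for i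
  proof -
    have "distr (Pi\<^sub>M {..<n} (\<lambda>_. N)) borel (\<lambda>x. x i) = distr (Pi\<^sub>M {..<n} (\<lambda>_. N)) N (\<lambda>x. x i)"
      by (intro distr_cong) auto
    also have "\<dots> = N"
      by (rule distr_PiM_component) (use that N.prob_space_axioms in auto)
    finally show ?thesis .
  qed
  \<comment> \<open>The joint law of the coordinates is the product measure itself: restriction is
    the identity on its space, and \<open>N\<close> carries the Borel sets.\<close>
  have ind: "P.indep_vars (\<lambda>_. borel) (\<lambda>i x. x i) {..<n}"
  proof (subst P.indep_vars_iff_distr_eq_PiM')
    have "distr (Pi\<^sub>M {..<n} (\<lambda>_. N)) (Pi\<^sub>M {..<n} (\<lambda>_. borel)) (\<lambda>x. \<lambda>i\<in>{..<n}. x i) =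
        distr (Pi\<^sub>M {..<n} (\<lambda>_. N)) (Pi\<^sub>M {..<n} (\<lambda>_. N)) (\<lambda>x. x)"
      by (intro distr_cong) (auto simp: space_PiM PiE_restrict cong: sets_PiM_cong)
    also have "\<dots> = Pi\<^sub>M {..<n} (\<lambda>_. N)" by (rule distr_id)
    also have "\<dots> = Pi\<^sub>M {..<n} (\<lambda>i. distr (Pi\<^sub>M {..<n} (\<lambda>_. N)) borel (\<lambda>x. x i))"
      by (intro PiM_cong refl) (simp add: component)
    finally show "distr (Pi\<^sub>M {..<n} (\<lambda>_. N)) (Pi\<^sub>M {..<n} (\<lambda>_. borel)) (\<lambda>x. \<lambda>i\<in>{..<n}. x i) =
        Pi\<^sub>M {..<n} (\<lambda>i. distr (Pi\<^sub>M {..<n} (\<lambda>_. N)) borel (\<lambda>x. x i))" .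
  qed (use n rv in \<open>auto simp: lessThan_empty_iff\<close>)
  have "distr (measure_pmf q) borel real = distr (Pi\<^sub>M {..<n} (\<lambda>_. N)) borel (\<lambda>x. \<Sum>i<n. x i)"
  proof (rule Levy_uniqueness)
    show "real_distribution (distr (measure_pmf q) borel real)"
      by (intro prob_space.real_distribution_distr measure_pmf.prob_space_axioms) simp
    show "real_distribution (distr (Pi\<^sub>M {..<n} (\<lambda>_. N)) borel (\<lambda>x. \<Sum>i<n. x i))"
      by (intro P.real_distribution_distr borel_measurable_sum rv) auto
    show "char (distr (measure_pmf q) borel real) =
        char (distr (Pi\<^sub>M {..<n} (\<lambda>_. N)) borel (\<lambda>x. \<Sum>i<n. x i))"
    proof
      fix t
      have "char (distr (Pi\<^sub>M {..<n} (\<lambda>_. N)) borel (\<lambda>x. \<Sum>i<n. x i)) t = char N t ^ n"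
        by (subst P.char_distr_sum[OF ind]) (simp add: component)
      also have "char N t = (\<Sum>k. of_real (R $ k) * iexp t ^ k)"
        using char_distr_pmf_nat[of r t] by (simp add: sums_iff N_def r)
      also have "\<dots> ^ n = char (distr (measure_pmf q) borel real) t"
        using sums_fps_power(2)[OF norm_R, of "iexp t" n] char_distr_pmf_nat[of q t]
        by (simp add: R A_def sums_iff)
      finally show "char (distr (measure_pmf q) borel real) t =
          char (distr (Pi\<^sub>M {..<n} (\<lambda>_. N)) borel (\<lambda>x. \<Sum>i<n. x i)) t" by simp
    qed
  qed
  then show "\<exists>N. real_distribution N \<and>
      distr (measure_pmf q) borel real = distr (Pi\<^sub>M {..<n} (\<lambda>_. N)) borel (\<lambda>x. \<Sum>i<n. x i)"
    using N by blast
qed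

section \<open>The first success in independent trials\<close>

lemma eq_enat_iff: "y = enat k \<longleftrightarrow> enat k \<le> y \<and> \<not> enat (Suc k) \<le> y"
  by (cases y) auto

lemma eq_infinity_iff: "y = \<infinity> \<longleftrightarrow> (\<forall>k. enat k \<le> y)"
  by (cases y) (auto simp: not_le gt_ex)

text \<open>A finite point is the difference of two consecutive tails, and \<infinity> is the
  intersection of all of them, reached by continuity from above.\<close>

lemma measure_eqI_enat_atLeast:
  fixes D E :: "enat measure"
  assumes "finite_measure D" "finite_measure E"
    and sets: "sets D = UNIV" "sets E = UNIV"
    and eq: "\<And>k. measure D {enat k..} = measure E {enat k..}"
  shows "D = E"
proof (rule measure_eqI_countable[of _ UNIV])
  interpret D: finite_measure D by fact
  interpret E: finite_measure E by fact
  fix x :: enat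
  have "measure D {x} = measure E {x}"
  proof (cases x)
    case (enat k)
    have "{x} = {enat k..} - {enat (Suc k)..}"
      unfolding enat using eq_enat_iff[of _ k] by blast
    moreover have "{enat (Suc k)..} \<subseteq> {enat k..}" by auto
    ultimately show ?thesis
      using eq[of k] eq[of "Suc k"] by (simp add: D.finite_measure_Diff E.finite_measure_Diff sets)
  next
    case infinity
    have x: "{x} = (\<Inter>k. {enat k..})"
      unfolding infinity using eq_infinity_iff by blast
    have "decseq (\<lambda>k. {enat k..})"
      by (auto simp: decseq_def intro: order_trans[rotated])
    then have "(\<lambda>k. measure D {enat k..}) \<longlonglongrightarrow> measure D {x}" "(\<lambda>k. measure E {enat k..}) \<longlonglongrightarrow> measure E {x}"
      unfolding x by (auto intro!: D.finite_Lim_measure_decseq E.finite_Lim_measure_decseq simp: sets)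
    then show ?thesis unfolding eq by (rule LIMSEQ_unique)
  qed
  then show "emeasure D {x} = emeasure E {x}"
    by (simp add: D.emeasure_eq_measure E.emeasure_eq_measure)
qed (simp_all add: sets)

text \<open>Covers the absence of any success too, where the infimum of the empty set is
  \<infinity>.\<close>

lemma le_first_success_iff:
  "enat (Suc k) \<le> Inf {enat i | i. i \<ge> 1 \<and> b i} \<longleftrightarrow> (\<forall>i\<in>{1..k}. \<not> b i)"
proof -
  have "enat (Suc k) \<le> Inf {enat i | i. i \<ge> 1 \<and> b i} \<longleftrightarrow> (\<forall>i\<ge>1. b i \<longrightarrow> enat (Suc k) \<le> enat i)"
    unfolding le_Inf_iff by blast
  then show ?thesis by (auto simp: not_less_eq_eq[symmetric])
qed

context prob_space
begin

text \<open>Independence yields the product of 1 - \<alpha>/i over i \<le> k, which obeys the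
  recursion of \<open>sibuya_tail\<close>.\<close>

lemma prob_no_success:
  assumes indep: "indep_vars (\<lambda>_. count_space UNIV) B {1::nat..}"
    and B: "\<And>i. i \<ge> 1 \<Longrightarrow> distr M (count_space UNIV) (B i) = measure_pmf (bernoulli_pmf (\<alpha> / real i))"
    and \<alpha>: "0 < \<alpha>" "\<alpha> < 1"
  shows "prob {\<omega> \<in> space M. \<forall>i\<in>{1..k}. \<not> B i \<omega>} = sibuya_tail \<alpha> k"
proof -
  have rv: "random_variable (count_space UNIV) (B i)" if "i \<ge> 1" for i
    using indep that by (auto simp: indep_vars_def)
  have single: "prob (B i -` {False} \<inter> space M) = 1 - \<alpha> / real i" if "i \<ge> 1" for i
  proof -
    have "prob (B i -` {False} \<inter> space M) = measure (distr M (count_space UNIV) (B i)) {False}"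
      using rv[OF that] by (simp add: measure_distr)
    also have "\<dots> = 1 - \<alpha> / real i"
      using \<alpha> that unfolding B[OF that] by (simp add: measure_pmf_single field_simps)
    finally show ?thesis .
  qed
  have tail: "sibuya_tail \<alpha> k = (\<Prod>i=1..k. 1 - \<alpha> / real i)"
    by (induction k) (simp_all add: sibuya_tail_Suc mult.commute)
  show ?thesis
  \<comment> \<open>An intersection over no indices would be the whole type instead of
    \<open>space M\<close>.\<close>
  proof (cases "k = 0")
    case True
    then show ?thesis by (simp add: prob_space)
  next
    case False
    have "{\<omega> \<in> space M. \<forall>i\<in>{1..k}. \<not> B i \<omega>} = (\<Inter>i\<in>{1..k}. B i -` {False} \<inter> space M)"
      using False by auto
    also have "prob \<dots> = (\<Prod>i\<in>{1..k}. prob (B i -` {False} \<inter> space M))"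
      using False by (intro indep_varsD[OF indep]) auto
    finally show ?thesis by (simp add: single tail)
  qed
qed

lemma measurable_first_success:
  assumes "\<And>i. i \<ge> 1 \<Longrightarrow> B i \<in> measurable M (count_space UNIV)"
  shows "(\<lambda>\<omega>. Inf {enat i | i. i \<ge> 1 \<and> B i \<omega>}) \<in> measurable M (count_space UNIV)"
proof -
  let ?T = "\<lambda>\<omega>. Inf {enat i | i. i \<ge> 1 \<and> B i \<omega>}"
  have B: "{\<omega> \<in> space M. B i \<omega>} \<in> events" if "i \<ge> 1" for i
    using assms[OF that] by (rule predE)
  have ge: "{\<omega> \<in> space M. enat k \<le> ?T \<omega>} \<in> events" for k
  proof (cases k)
    case 0
    then show ?thesis by (simp add: zero_enat_def[symmetric])
  next
    case (Suc j)
    have "{\<omega> \<in> space M. \<forall>i\<in>{1..j}. \<not> B i \<omega>} = space M - (\<Union>i\<in>{1..j}. {\<omega> \<in> space M. B i \<omega>})"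
      by auto
    moreover have "(\<Union>i\<in>{1..j}. {\<omega> \<in> space M. B i \<omega>}) \<in> events"
      by (intro sets.finite_UN) (use B in auto)
    ultimately show ?thesis unfolding Suc le_first_success_iff by auto
  qed
  show ?thesis
  proof (subst measurable_count_space_eq2_countable, intro conjI ballI)
    fix x :: enat
    show "?T -` {x} \<inter> space M \<in> events"
    proof (cases x)
      case (enat k)
      have "?T -` {x} \<inter> space M = {\<omega> \<in> space M. enat k \<le> ?T \<omega>} - {\<omega> \<in> space M. enat (Suc k) \<le> ?T \<omega>}"
        unfolding enat using eq_enat_iff[of _ k] by blast
      then show ?thesis using ge by auto
    next
      case infinity
      have "?T -` {x} \<inter> space M = (\<Inter>k. {\<omega> \<in> space M. enat k \<le> ?T \<omega>})"
        unfolding infinity using eq_infinity_iff by blast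
      then show ?thesis using ge by auto
    qed
  qed auto
qed

end

section \<open>Recurrence of stationary chains\<close>

text \<open>Nonnegative extended integrals decompose along \<open>bind_pmf\<close>; the bounds make
  all of them finite, which brings the identity back to real expectations.\<close>

lemma expectation_bind_pmf:
  fixes f :: "'b \<Rightarrow> real"
  assumes "\<And>x. 0 \<le> f x" "\<And>x. f x \<le> B"
  shows "measure_pmf.expectation (bind_pmf p K) f =
    measure_pmf.expectation p (\<lambda>x. measure_pmf.expectation (K x) f)"
proof -
  have B: "B \<ge> 0" using assms order_trans by blast
  have int: "integrable (measure_pmf q) f" for q
    by (rule measure_pmf.integrable_const_bound[where B = B]) (use assms in auto)
  have bound: "0 \<le> measure_pmf.expectation (K x) f \<and> measure_pmf.expectation (K x) f \<le> B" for x
    using assms by (auto intro!: integral_nonneg measure_pmf.integral_le_const int)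
  have int': "integrable (measure_pmf p) (\<lambda>x. measure_pmf.expectation (K x) f)"
    by (rule measure_pmf.integrable_const_bound[where B = B]) (use bound in auto)
  have "ennreal (measure_pmf.expectation (bind_pmf p K) f) = (\<integral>\<^sup>+x. ennreal (f x) \<partial>bind_pmf p K)"
    using assms by (intro nn_integral_eq_integral[symmetric] int) auto
  also have "\<dots> = (\<integral>\<^sup>+x. ennreal (measure_pmf.expectation (K x) f) \<partial>p)"
    using assms by (simp add: nn_integral_eq_integral[OF int])
  also have "\<dots> = ennreal (measure_pmf.expectation p (\<lambda>x. measure_pmf.expectation (K x) f))"
    using bound by (intro nn_integral_eq_integral int') auto
  finally show ?thesis
    using bound assms by (subst (asm) ennreal_inj) (auto intro!: integral_nonneg)
qed

lemma prob_bind_pmf: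
  "measure_pmf.prob (bind_pmf p K) A = measure_pmf.expectation p (\<lambda>x. measure_pmf.prob (K x) A)"
proof -
  have "measure_pmf.prob q A = measure_pmf.expectation q (indicator A)" for q :: "'a pmf"
    by simp
  then show ?thesis
    using expectation_bind_pmf[of "indicator A" 1 p K] by (simp add: indicator_le_1)
qed

text \<open>Only the times 1 to n are tested, so the start k = i is allowed; there the value is the
  probability that the return time exceeds n.\<close>

definition avoid_prob :: "('s \<Rightarrow> 's pmf) \<Rightarrow> 's \<Rightarrow> nat \<Rightarrow> 's \<Rightarrow> real" where
  "avoid_prob K i n k = measure_pmf.prob (path_pmf K n k) {xs. i \<notin> set xs}"

lemma avoid_prob_0 [simp]: "avoid_prob K i 0 k = 1"
  by (simp add: avoid_prob_def)

lemma avoid_prob_bounds: "0 \<le> avoid_prob K i n k" "avoid_prob K i n k \<le> 1"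
  by (simp_all add: avoid_prob_def)

lemma avoid_prob_Suc:
  "avoid_prob K i (Suc n) k =
     measure_pmf.expectation (K k) (\<lambda>x. if x = i then 0 else avoid_prob K i n x)"
proof -
  have "measure_pmf.prob (map_pmf ((#) x) (path_pmf K n x)) {xs. i \<notin> set xs} =
      (if x = i then 0 else avoid_prob K i n x)" for x
    by (auto simp: avoid_prob_def vimage_def)
  then show ?thesis
    by (simp add: avoid_prob_def prob_bind_pmf)
qed

section \<open>Truncated paths and first return times\<close>

lemma length_path_pmf: "xs \<in> set_pmf (path_pmf K n i) \<Longrightarrow> length xs = n"
  by (induction n arbitrary: i xs) auto

text \<open>Paths are built from the front, so dropping the last entry takes an induction. This puts
  events about n and n + 1 steps on one space.\<close>

lemma path_pmf_take:
  "map_pmf (take n) (path_pmf K (Suc n) i) = path_pmf K n i"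
proof (induction n arbitrary: i)
  case 0
  then show ?case by (simp add: map_bind_pmf map_pmf_comp map_pmf_const)
next
  case (Suc n)
  have "map_pmf (take (Suc n)) (path_pmf K (Suc (Suc n)) i) =
      bind_pmf (K i) (\<lambda>k. map_pmf ((#) k) (map_pmf (take n) (path_pmf K (Suc n) k)))"
    by (simp only: path_pmf.simps(2)[of K "Suc n"] map_bind_pmf map_pmf_comp take_Suc_Cons)
  also have "\<dots> = path_pmf K (Suc n) i"
    unfolding Suc.IH by simp
  finally show ?case .
qed

text \<open>A first return at time n + 1 means avoiding i up to time n but not up to time n + 1, and
  the latter avoidance implies the former.\<close>

lemma first_return_prob_eq:
  "first_return_prob K i n = avoid_prob K i n i - avoid_prob K i (Suc n) i"
proof -
  let ?P = "path_pmf K (Suc n) i"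
  have "avoid_prob K i n i = measure_pmf.prob ?P {xs. i \<notin> set (take n xs)}"
    unfolding avoid_prob_def path_pmf_take[of n K i, symmetric] measure_map_pmf vimage_def by simp
  moreover have "avoid_prob K i (Suc n) i = measure_pmf.prob ?P ({xs. i \<notin> set xs} \<inter> {xs. i \<notin> set (take n xs)})"
    unfolding avoid_prob_def by (intro arg_cong[where f = "measure_pmf.prob ?P"]) (auto dest: in_set_takeD)
  moreover have "first_return_prob K i n =
      measure_pmf.prob ?P ({xs. i \<notin> set (take n xs)} - {xs. i \<notin> set xs} \<inter> {xs. i \<notin> set (take n xs)})"
    unfolding first_return_prob_def
  \<comment> \<open>The two events are compared on lists of length n + 1 only, where
    \<open>xs ! n\<close> is the last entry; almost every path has this length.\<close>
  proof (intro measure_pmf.finite_measure_eq_AE)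
    show "AE xs in ?P. (xs \<in> {xs. xs ! n = i \<and> (\<forall>m<n. xs ! m \<noteq> i)}) =
       (xs \<in> {xs. i \<notin> set (take n xs)} - {xs. i \<notin> set xs} \<inter> {xs. i \<notin> set (take n xs)})"
    proof (rule AE_pmfI)
      fix xs assume "xs \<in> set_pmf ?P"
      then have "length xs = Suc n" by (rule length_path_pmf)
      then show "(xs \<in> {xs. xs ! n = i \<and> (\<forall>m<n. xs ! m \<noteq> i)}) =
       (xs \<in> {xs. i \<notin> set (take n xs)} - {xs. i \<notin> set xs} \<inter> {xs. i \<notin> set (take n xs)})"
        by (auto simp: in_set_conv_nth less_Suc_eq)
    qed
  qed auto
  ultimately show ?thesis
    by (simp add: measure_pmf.finite_measure_Diff)
qed

text \<open>By stationarity, the probability that the chain started from \<open>p\<close> is at \<open>i\<close> at time \<open>0\<close> and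
  avoids it at the times \<open>1, \<dots>, n\<close> is a difference of consecutive terms of the sequence
  \<open>\<Sum>k. p k * avoid_prob K i n k\<close>, so the expected return time is at most \<open>1 / p i\<close>.\<close>

lemma positive_recurrent_if_stationary:
  assumes stat: "bind_pmf p K = p" and i: "pmf p i > 0"
  shows "first_return_prob K i sums 1" "summable (\<lambda>n. real (Suc n) * first_return_prob K i n)"
proof -
  define s where "s = (\<lambda>n. avoid_prob K i n i)"
  define a where "a = (\<lambda>n. measure_pmf.expectation p (avoid_prob K i n))"
  have int: "integrable (measure_pmf p) (avoid_prob K i n)" for n
    by (rule measure_pmf.integrable_const_bound[where B = 1]) (use avoid_prob_bounds[of K i n] in auto)
  have a01: "0 \<le> a n" "a n \<le> 1" for n
    unfolding a_def using avoid_prob_bounds[of K i n]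
    by (auto intro!: integral_nonneg measure_pmf.integral_le_const int)
  have step: "pmf p i * s n = a n - a (Suc n)" for n
  proof -
    have [simp]: "integrable (measure_pmf p) (indicat_real {i})"
      by (rule measure_pmf.integrable_const_bound[where B = 1]) auto
    have "a (Suc n) = measure_pmf.expectation (bind_pmf p K) (\<lambda>x. if x = i then 0 else avoid_prob K i n x)"
      unfolding a_def using avoid_prob_bounds[of K i n]
      by (subst expectation_bind_pmf[where B = 1]) (auto simp: avoid_prob_Suc[abs_def])
    \<comment> \<open>Stationarity turns the law after one step back into \<open>p\<close>;
      excluding i then costs its mass times \<open>s n\<close>.\<close>
    also have "\<dots> = measure_pmf.expectation p (\<lambda>x. avoid_prob K i n x - s n * indicator {i} x)"
      unfolding stat by (intro Bochner_Integration.integral_cong) (auto simp: s_def)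
    also have "\<dots> = a n - s n * pmf p i"
      by (subst Bochner_Integration.integral_diff) (auto simp: a_def int measure_pmf_single)
    finally show ?thesis by (simp add: mult.commute)
  qed
  have s_nn: "s n \<ge> 0" for n by (simp add: s_def avoid_prob_bounds)
  have sum_s: "(\<Sum>n<N. s n) \<le> 1 / pmf p i" for N
  proof -
    have "pmf p i * (\<Sum>n<N. s n) = a 0 - a N"
      by (simp add: sum_distrib_left step sum_lessThan_telescope')
    also have "\<dots> \<le> 1" using a01[of 0] a01[of N] by simp
    finally show ?thesis using i by (simp add: field_simps)
  qed
  have summable_s: "summable s"
    by (rule bounded_imp_summable[where B = "1 / pmf p i"])
      (use s_nn sum_s[of "Suc _"] in \<open>auto simp: lessThan_Suc_atMost\<close>)
  have f: "first_return_prob K i n = s n - s (Suc n)" for n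
    by (simp add: first_return_prob_eq s_def)
  have f_nn: "first_return_prob K i n \<ge> 0" for n by (simp add: first_return_prob_def)
  \<comment> \<open>Summability forces \<open>s n\<close> to 0, so the chain returns almost
    surely.\<close>
  have "(\<lambda>n. s n - s (Suc n)) sums (s 0 - 0)"
    by (rule telescope_sums') (rule summable_LIMSEQ_zero[OF summable_s])
  then show "first_return_prob K i sums 1"
    by (simp add: f[abs_def] s_def)
  \<comment> \<open>Summation by parts; the boundary term is nonpositive, so the bound on the sums
    of \<open>s\<close> carries over.\<close>
  have part: "(\<Sum>n<N. real (Suc n) * first_return_prob K i n) = (\<Sum>n<N. s n) - real N * s N" for N
    by (induction N) (simp_all add: f algebra_simps)
  show "summable (\<lambda>n. real (Suc n) * first_return_prob K i n)"
  proof (rule bounded_imp_summable[where B = "1 / pmf p i"])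
    fix n
    have "(\<Sum>k<Suc n. real (Suc k) * first_return_prob K i k) \<le> (\<Sum>n<Suc n. s n)"
      unfolding part using s_nn[of "Suc n"] by simp
    then show "(\<Sum>k\<le>n. real (Suc k) * first_return_prob K i k) \<le> 1 / pmf p i"
      using sum_s[of "Suc n"] by (simp only: lessThan_Suc_atMost)
  qed (use f_nn in simp)
qed

section \<open>The Lamperti chain of the Sibuya distribution\<close>

text \<open>Given X = n, the maximum is at most j with probability F(j)^n. Averaging gives
  \<Phi>(F(j)), which the choice of F makes equal to P(X \<le> j).\<close>

lemma lamperti_stationary:
  assumes \<alpha>: "0 < \<alpha>" "\<alpha> < 1"
    and \<nu>: "\<And>i. measure_pmf.prob \<nu> {..i} = 1 - sibuya_tail \<alpha> i powr (1 / \<alpha>)"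
  shows "bind_pmf (map_pmf Suc (sibuya_pmf \<alpha>)) (lamperti_kernel \<nu>) = map_pmf Suc (sibuya_pmf \<alpha>)"
proof (rule pmf_nat_eqI_atMost)
  fix j
  have F: "cdf_nat \<nu> j = 1 - sibuya_tail \<alpha> j powr (1 / \<alpha>)" by (simp add: cdf_nat_def \<nu>)
  have F01: "0 \<le> cdf_nat \<nu> j" "cdf_nat \<nu> j \<le> 1" by (simp_all add: cdf_nat_def)
  have "measure_pmf.prob (bind_pmf (map_pmf Suc (sibuya_pmf \<alpha>)) (lamperti_kernel \<nu>)) {..j} =
      pgf (measure_pmf (sibuya_pmf \<alpha>)) Suc (cdf_nat \<nu> j)"
    by (simp add: prob_bind_pmf bind_map_pmf lamperti_kernel_cdf pgf_def)
  also have "\<dots> = 1 - sibuya_tail \<alpha> j"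
    using \<alpha> F01 sibuya_tail_pos[of \<alpha> j] by (subst pgf_sibuya_pmf) (auto simp: F powr_powr)
  also have "\<dots> = measure_pmf.prob (map_pmf Suc (sibuya_pmf \<alpha>)) {..j}"
    using sibuya_pmf(2)[OF \<alpha>, of j] by (simp add: vimage_def Suc_le_eq lessThan_def)
  finally show "measure_pmf.prob (bind_pmf (map_pmf Suc (sibuya_pmf \<alpha>)) (lamperti_kernel \<nu>)) {..j} =
      measure_pmf.prob (map_pmf Suc (sibuya_pmf \<alpha>)) {..j}" .
qed

lemma pmf_Suc_sibuya_pmf:
  assumes "0 < \<alpha>" "\<alpha> < 1" "i \<ge> 1"
  shows "pmf (map_pmf Suc (sibuya_pmf \<alpha>)) i = sibuya \<alpha> i"
proof -
  obtain k where "i = Suc k" using assms(3) by (cases i) auto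
  then show ?thesis using assms sibuya_pmf(1) by (simp add: pmf_map_inj')
qed

lemma lamperti_recurrent_invariant:
  assumes \<alpha>: "0 < \<alpha>" "\<alpha> < 1"
    and \<nu>: "\<And>i. measure_pmf.prob \<nu> {..i} = 1 - sibuya_tail \<alpha> i powr (1 / \<alpha>)"
  shows "positive_recurrent (lamperti_kernel \<nu>) {1..}"
    and "invariant_probability (lamperti_kernel \<nu>) {1..} (sibuya \<alpha>)"
proof -
  note stat = lamperti_stationary[OF \<alpha> \<nu>]
  note pmf = pmf_Suc_sibuya_pmf[OF \<alpha>]
  show "positive_recurrent (lamperti_kernel \<nu>) {1..}"
    unfolding positive_recurrent_def
  proof
    fix i :: nat assume "i \<in> {1..}"
    then have "pmf (map_pmf Suc (sibuya_pmf \<alpha>)) i > 0" using pmf[of i] sibuya_pos[of \<alpha> i] \<alpha> by simp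
    from positive_recurrent_if_stationary[OF stat this]
    show "first_return_prob (lamperti_kernel \<nu>) i sums 1 \<and>
        summable (\<lambda>n. real (Suc n) * first_return_prob (lamperti_kernel \<nu>) i n)" by blast
  qed
  have has_sum_shift: "(f has_sum s) {1..}" if "(\<lambda>n. f (Suc n)) sums s" "\<And>n. f (Suc n) \<ge> 0" for f :: "nat \<Rightarrow> real" and s
  proof -
    have "((\<lambda>n. f (Suc n)) has_sum s) UNIV" by (rule sums_nonneg_imp_has_sum) (use that in auto)
    then have "(f has_sum s) (range Suc)" by (subst has_sum_reindex) (simp_all add: o_def)
    also have "range Suc = {1..}" by (auto simp: image_iff Suc_le_eq gr0_conv_Suc)
    finally show ?thesis .
  qed
  have "((\<lambda>i. sibuya \<alpha> i * pmf (lamperti_kernel \<nu> i) j) has_sum sibuya \<alpha> j) {1..}" if "j \<ge> 1" for j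
  proof (rule has_sum_shift)
    have "(\<lambda>n. pmf (sibuya_pmf \<alpha>) n *\<^sub>R pmf (lamperti_kernel \<nu> (Suc n)) j) sums
        measure_pmf.expectation (sibuya_pmf \<alpha>) (\<lambda>n. pmf (lamperti_kernel \<nu> (Suc n)) j)"
      by (rule sums_integral_pmf_nat[where B = 1]) (simp add: pmf_le_1)
    also have "measure_pmf.expectation (sibuya_pmf \<alpha>) (\<lambda>n. pmf (lamperti_kernel \<nu> (Suc n)) j) =
        pmf (bind_pmf (map_pmf Suc (sibuya_pmf \<alpha>)) (lamperti_kernel \<nu>)) j"
      by (simp add: pmf_bind)
    also have "\<dots> = sibuya \<alpha> j" unfolding stat by (rule pmf[OF that])
    finally show "(\<lambda>n. sibuya \<alpha> (Suc n) * pmf (lamperti_kernel \<nu> (Suc n)) j) sums sibuya \<alpha> j"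
      by (simp add: sibuya_pmf(1)[OF \<alpha>])
  qed (use sibuya_pos[OF \<alpha>] in \<open>simp add: less_imp_le\<close>)
  moreover have "(sibuya \<alpha> has_sum 1) {1..}"
    using sibuya_sums_1[OF \<alpha>] sibuya_pos[OF \<alpha>] by (intro has_sum_shift) (auto simp: less_imp_le)
  ultimately show "invariant_probability (lamperti_kernel \<nu>) {1..} (sibuya \<alpha>)"
    using sibuya_pos[OF \<alpha>] by (auto simp: invariant_probability_def less_imp_le)
qed

section \<open>A random variable with the Sibuya law\<close>

locale sibuya_variable = prob_space M for M :: "'a measure" +
  fixes X :: "'a \<Rightarrow> nat" and \<alpha> :: real
  assumes alpha: "0 < \<alpha>" "\<alpha> < 1"
    and rv [measurable]: "X \<in> measurable M (count_space UNIV)"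
    and law: "\<And>j. j \<ge> 1 \<Longrightarrow> prob {\<omega> \<in> space M. X \<omega> = j} = sibuya \<alpha> j"
begin

text \<open>The law is prescribed for j \<ge> 1 only, but the weights sum to 1, so the point 0 has
  mass 0.\<close>

lemma distr_eq_pmf: "distr M (count_space UNIV) X = measure_pmf (map_pmf Suc (sibuya_pmf \<alpha>))"
proof (rule measure_eqI_countable[of _ UNIV])
  interpret D: prob_space "distr M (count_space UNIV) X" by (rule prob_space_distr[OF rv])
  let ?m = "\<lambda>j. measure (distr M (count_space UNIV) X) {j}"
  have m: "?m j = prob {\<omega> \<in> space M. X \<omega> = j}" for j
    using rv by (simp add: measure_distr vimage_def Int_def conj_commute)
  have "?m sums measure (distr M (count_space UNIV) X) (\<Union>j. {j})"
    by (rule D.finite_measure_UNION) (auto simp: disjoint_family_on_def)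
  also have "measure (distr M (count_space UNIV) X) (\<Union>j. {j}) = 1" using D.prob_space by simp
  finally have "(\<lambda>j. ?m (Suc j)) sums (1 - ?m 0)" by (subst sums_Suc_iff) simp
  moreover have "(\<lambda>j. ?m (Suc j)) sums 1"
    using sibuya_sums_1[OF alpha] by (simp add: m law)
  ultimately have m0: "?m 0 = 0" using sums_unique2 by fastforce
  fix j
  have "?m j = pmf (map_pmf Suc (sibuya_pmf \<alpha>)) j"
  proof (cases "j = 0")
    case True
    have "pmf (map_pmf Suc (sibuya_pmf \<alpha>)) 0 = 0" by (auto simp: pmf_eq_0_set_pmf)
    then show ?thesis using True m0 by simp
  qed (simp add: m law pmf_Suc_sibuya_pmf alpha)
  then show "emeasure (distr M (count_space UNIV) X) {j} = emeasure (measure_pmf (map_pmf Suc (sibuya_pmf \<alpha>))) {j}"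
    by (simp add: D.emeasure_eq_measure emeasure_pmf_single)
qed auto

lemma prob_eq: "prob {\<omega> \<in> space M. P (X \<omega>)} = measure_pmf.prob (sibuya_pmf \<alpha>) {n. P (Suc n)}"
proof -
  have "prob {\<omega> \<in> space M. P (X \<omega>)} = measure (distr M (count_space UNIV) X) {n. P n}"
    using rv by (simp add: measure_distr vimage_def Int_def conj_commute)
  then show ?thesis unfolding distr_eq_pmf by (simp add: vimage_def)
qed

lemma prob_le: "prob {\<omega> \<in> space M. X \<omega> \<le> i} = 1 - sibuya_tail \<alpha> i"
  using sibuya_pmf(2)[OF alpha, of i] by (simp add: prob_eq[of "\<lambda>n. n \<le> i"] Suc_le_eq lessThan_def)

lemma prob_gt: "prob {\<omega> \<in> space M. i < X \<omega>} = sibuya_tail \<alpha> i"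
proof -
  have "{\<omega> \<in> space M. i < X \<omega>} = space M - {\<omega> \<in> space M. X \<omega> \<le> i}" by auto
  then show ?thesis using prob_le[of i] by (simp add: prob_compl)
qed

lemma pgf_eq:
  assumes "\<bar>z\<bar> \<le> 1"
  shows "pgf M X z = 1 - (1 - z) powr \<alpha>"
proof -
  have "pgf M X z = (\<integral>n. z ^ n \<partial>distr M (count_space UNIV) X)"
    using rv by (simp add: pgf_def integral_distr)
  also have "\<dots> = pgf (measure_pmf (sibuya_pmf \<alpha>)) Suc z"
    unfolding distr_eq_pmf by (simp add: pgf_def)
  finally show ?thesis using pgf_sibuya_pmf[OF alpha assms] by simp
qed

text \<open>The rate is exactly \<alpha>/j, since the weight at j is \<alpha>/j times P(X \<ge>
  j).\<close>

lemma failure_rate: "decreasing_failure_rate M X"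
  unfolding decreasing_failure_rate_def
proof (rule monotone_onI)
  have rate: "prob {\<omega> \<in> space M. X \<omega> = j} / prob {\<omega> \<in> space M. j \<le> X \<omega>} = \<alpha> / real j" if "j \<ge> 1" for j
  proof -
    obtain k where k: "j = Suc k" using \<open>j \<ge> 1\<close> by (cases j) auto
    show ?thesis
      using prob_gt[of k] law[OF that] sibuya_tail_pos[of \<alpha> k] alpha
      by (simp add: k Suc_le_eq sibuya_Suc_eq_tail)
  qed
  fix i j :: nat assume "i \<in> {1..}" "j \<in> {1..}" "i \<le> j"
  then show "prob {\<omega> \<in> space M. X \<omega> = i} / prob {\<omega> \<in> space M. i \<le> X \<omega>}
      \<ge> prob {\<omega> \<in> space M. X \<omega> = j} / prob {\<omega> \<in> space M. j \<le> X \<omega>}"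
    using alpha by (simp add: rate frac_le)
qed

lemma infinitely_divisible_pred: "infinitely_divisible (distr M borel (\<lambda>\<omega>. real (X \<omega>) - 1))"
proof -
  have "distr M borel (\<lambda>\<omega>. real (X \<omega>) - 1) = distr (distr M (count_space UNIV) X) borel (\<lambda>n. real n - 1)"
    using rv by (subst distr_distr) (auto simp: o_def)
  also have "\<dots> = distr (measure_pmf (sibuya_pmf \<alpha>)) borel real"
    unfolding distr_eq_pmf map_pmf_rep_eq by (subst distr_distr) (auto simp: o_def)
  finally have eq: "distr M borel (\<lambda>\<omega>. real (X \<omega>) - 1) = distr (measure_pmf (sibuya_pmf \<alpha>)) borel real" .
  have "pmf (sibuya_pmf \<alpha>) = (\<lambda>j. sibuya \<alpha> (Suc j))"
    by (rule ext) (rule sibuya_pmf(1)[OF alpha])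
  then have "log_convex_seq (pmf (sibuya_pmf \<alpha>))"
    using log_convex_sibuya[OF alpha] by simp
  then have "infinitely_divisible (distr (measure_pmf (sibuya_pmf \<alpha>)) borel real)"
    by (rule infinitely_divisible_log_convex)
  with eq show ?thesis by simp
qed

lemma algebraic_tails_sibuya: "algebraic_tails M X \<alpha>"
proof -
  have "1 / Gamma (1 - \<alpha>) > 0" using alpha by (simp add: Gamma_real_pos)
  then show ?thesis
    using sibuya_tail_asymp[OF alpha] unfolding algebraic_tails_def prob_gt by blast
qed

text \<open>Since 1 - F is nonnegative, the power 1/\<alpha> inverts the power \<alpha> and the
  equation can be solved for F.\<close>

lemma lamperti_generator_iff:
  "lamperti_generator M X \<nu> \<longleftrightarrow> set_pmf \<nu> \<subseteq> {1..} \<and>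
     (\<forall>i\<ge>1. measure_pmf.prob \<nu> {..i} = 1 - sibuya_tail \<alpha> i powr (1 / \<alpha>))"
proof -
  have "1 - t = 1 - (1 - F) powr \<alpha> \<longleftrightarrow> F = 1 - t powr (1 / \<alpha>)" if "0 < t" "F \<le> 1" for t F :: real
  proof
    assume "1 - t = 1 - (1 - F) powr \<alpha>"
    then have "t powr (1 / \<alpha>) = (1 - F) powr (\<alpha> * (1 / \<alpha>))" by (simp add: powr_powr)
    then show "F = 1 - t powr (1 / \<alpha>)" using alpha that by simp
  next
    assume "F = 1 - t powr (1 / \<alpha>)"
    then show "1 - t = 1 - (1 - F) powr \<alpha>" using alpha that by (simp add: powr_powr)
  qed
  then have "1 - sibuya_tail \<alpha> i = pgf M X (cdf_nat \<nu> i) \<longleftrightarrow>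
      measure_pmf.prob \<nu> {..i} = 1 - sibuya_tail \<alpha> i powr (1 / \<alpha>)" for i
    using sibuya_tail_pos[of \<alpha> i] alpha by (subst pgf_eq) (simp_all add: cdf_nat_def)
  then show ?thesis by (simp add: lamperti_generator_def prob_le)
qed

text \<open>Extends the formula to i = 0, where no equation is imposed: the support of \<nu> gives
  F(0) = 0, and the tail at 0 is 1.\<close>

lemma lamperti_generator_cdf:
  assumes "lamperti_generator M X \<nu>"
  shows "measure_pmf.prob \<nu> {..i} = 1 - sibuya_tail \<alpha> i powr (1 / \<alpha>)"
proof (cases "i = 0")
  case True
  have "measure_pmf.prob \<nu> {..0} = 0"
    using assms by (auto simp: lamperti_generator_iff measure_pmf_zero_iff)
  then show ?thesis by (simp add: True)
qed (use assms in \<open>simp add: lamperti_generator_iff\<close>)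

lemma lamperti_generator_tail:
  assumes "lamperti_generator M X \<nu>"
  shows "measure_pmf.prob \<nu> {i<..} = sibuya_tail \<alpha> i powr (1 / \<alpha>)"
proof -
  have "{i<..} = space (measure_pmf \<nu>) - {..i}" by auto
  then show ?thesis
    using lamperti_generator_cdf[OF assms, of i] by (simp only: measure_pmf.prob_compl sets_measure_pmf UNIV_I)
qed

text \<open>The powers of the tail decrease from 1 to 0, so they are a survival function; shifting
  its law by one gives \<nu>. Uniqueness holds because F is determined everywhere.\<close>

lemma ex1_lamperti_generator: "\<exists>!\<nu>. lamperti_generator M X \<nu>"
proof (rule ex_ex1I)
  define p where "p = pmf_of_survival (\<lambda>n. sibuya_tail \<alpha> n powr (1 / \<alpha>))"
  have "(\<lambda>n. sibuya_tail \<alpha> n powr (1 / \<alpha>)) \<longlonglongrightarrow> 0 powr (1 / \<alpha>)"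
    using alpha sibuya_tail_pos[of \<alpha>]
    by (intro tendsto_powr' sibuya_tail_tendsto_0 tendsto_const) (auto intro!: always_eventually simp: less_imp_le)
  then have p: "measure_pmf.prob p {..<n} = 1 - sibuya_tail \<alpha> n powr (1 / \<alpha>)" for n
    unfolding p_def using alpha sibuya_tail_pos[of \<alpha>]
    by (intro pmf_of_survival(2)) (auto intro!: powr_mono2 sibuya_tail_antimono simp: less_imp_le)
  have "lamperti_generator M X (map_pmf Suc p)"
    using p by (auto simp: lamperti_generator_iff vimage_def Suc_le_eq lessThan_def)
  then show "\<exists>\<nu>. lamperti_generator M X \<nu>" by blast
next
  fix \<nu> \<nu>' assume "lamperti_generator M X \<nu>" "lamperti_generator M X \<nu>'"
  then show "\<nu> = \<nu>'" by (intro pmf_nat_eqI_atMost) (simp add: lamperti_generator_cdf)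
qed

section \<open>Distribution function and tail of \<nu>\<close>

lemma lamperti_generator_cdf_sum:
  assumes "lamperti_generator M X \<nu>"
  shows "measure_pmf.prob \<nu> {..i} =
    1 - (1 - \<alpha> * (\<Sum>j=1..i. pochhammer (1 - \<alpha>) (j - 1) / fact j)) powr (1 / \<alpha>)"
  using sum_sibuya[of \<alpha> i] by (simp add: lamperti_generator_cdf[OF assms] sibuya_def sum_distrib_left)

lemma lamperti_generator_tail_asymp:
  assumes "lamperti_generator M X \<nu>"
  shows "(\<lambda>i. measure_pmf.prob \<nu> {i<..}) \<sim>[at_top]
    (\<lambda>i. 1 / Gamma (1 - \<alpha>) powr (1 / \<alpha>) * inverse (real i))"
  unfolding lamperti_generator_tail[OF assms] by (rule sibuya_tail_powr_asymp[OF alpha])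

lemma algebraic_tails_lamperti_generator:
  assumes "lamperti_generator M X \<nu>"
  shows "algebraic_tails (measure_pmf \<nu>) (\<lambda>k. k) 1"
proof -
  have "Gamma (1 - \<alpha>) \<noteq> 0"
    using Gamma_real_pos[of "1 - \<alpha>"] alpha by (intro less_imp_neq[symmetric]) auto
  then have "1 / Gamma (1 - \<alpha>) powr (1 / \<alpha>) > 0" by simp
  moreover have "{k. i < k} = {i<..}" for i :: nat by auto
  moreover have "real j powr (-1) = inverse (real j)" for j by (simp add: powr_minus)
  ultimately show ?thesis
    using lamperti_generator_tail_asymp[OF assms] unfolding algebraic_tails_def
    by (intro exI[of _ "1 / Gamma (1 - \<alpha>) powr (1 / \<alpha>)"]) simp
qed

text \<open>Both P(X > j) and the probability that the first j trials fail equal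
  \<open>sibuya_tail \<alpha> j\<close>, and tails determine a law on \<open>enat\<close>.\<close>

lemma distr_first_success:
  fixes N :: "'b measure"
  assumes N: "prob_space N"
    and indep: "prob_space.indep_vars N (\<lambda>_. count_space UNIV) B {1::nat..}"
    and B: "\<And>i. i \<ge> 1 \<Longrightarrow> distr N (count_space UNIV) (B i) = measure_pmf (bernoulli_pmf (\<alpha> / real i))"
  shows "distr M (count_space UNIV) (\<lambda>\<omega>. enat (X \<omega>)) =
    distr N (count_space UNIV) (\<lambda>\<omega>. Inf {enat i | i. i \<ge> 1 \<and> B i \<omega>})"
proof (rule measure_eqI_enat_atLeast)
  interpret N: prob_space N by (rule N)
  let ?T = "\<lambda>\<omega>. Inf {enat i | i. i \<ge> 1 \<and> B i \<omega>}"
  have T: "?T \<in> measurable N (count_space UNIV)"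
    using indep by (intro N.measurable_first_success) (auto simp: N.indep_vars_def)
  have X: "(\<lambda>\<omega>. enat (X \<omega>)) \<in> measurable M (count_space UNIV)"
    using rv by (rule measurable_compose) simp
  show "finite_measure (distr M (count_space UNIV) (\<lambda>\<omega>. enat (X \<omega>)))"
    using X by (rule finite_measure_distr)
  show "finite_measure (distr N (count_space UNIV) ?T)"
    using T by (rule N.finite_measure_distr)
  fix k
  have l: "measure (distr M (count_space UNIV) (\<lambda>\<omega>. enat (X \<omega>))) {enat k..} = prob {\<omega> \<in> space M. k \<le> X \<omega>}"
    using X by (simp add: measure_distr vimage_def Int_def conj_commute)
  have r: "measure (distr N (count_space UNIV) ?T) {enat k..} = N.prob {\<omega> \<in> space N. enat k \<le> ?T \<omega>}"
    using T by (simp add: measure_distr vimage_def Int_def conj_commute)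
  show "measure (distr M (count_space UNIV) (\<lambda>\<omega>. enat (X \<omega>))) {enat k..} =
      measure (distr N (count_space UNIV) ?T) {enat k..}"
  proof (cases k)
    case 0
    then show ?thesis
      unfolding l r by (simp add: zero_enat_def[symmetric] prob_space N.prob_space)
  next
    case (Suc j)
    show ?thesis
      unfolding l r unfolding Suc le_first_success_iff
      using prob_gt[of j] N.prob_no_success[OF indep B alpha, of j] by (simp add: Suc_le_eq)
  qed
qed auto

end

theorem proposition4:
  fixes \<alpha> :: real and M :: "'a measure" and X :: "'a \<Rightarrow> nat"
  assumes "0 < \<alpha>" and "\<alpha> < 1"
    and "prob_space M" and "X \<in> measurable M (count_space UNIV)"
    and "\<And>j. j \<ge> 1 \<Longrightarrow> measure M {\<omega> \<in> space M. X \<omega> = j} = sibuya \<alpha> j"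
  shows
    "(\<forall>z. \<bar>z\<bar> \<le> 1 \<longrightarrow> pgf M X z = 1 - (1 - z) powr \<alpha>) \<and>
     \<comment> \<open>(i)\<close>
     (completely_monotone (\<lambda>j. sibuya \<alpha> (Suc j)) \<and>
      log_convex_seq (\<lambda>j. sibuya \<alpha> (Suc j)) \<and>
      decreasing_failure_rate M X \<and>
      infinitely_divisible (distr M borel (\<lambda>\<omega>. real (X \<omega>) - 1))) \<and>
     \<comment> \<open>(ii)\<close>
     (\<forall>(N :: 'b measure) B.
        prob_space N \<and> prob_space.indep_vars N (\<lambda>_. count_space UNIV) B {1::nat..} \<and>
        (\<forall>i\<ge>1. distr N (count_space UNIV) (B i) = measure_pmf (bernoulli_pmf (\<alpha> / real i))) \<longrightarrow>
        distr M (count_space UNIV) (\<lambda>\<omega>. enat (X \<omega>)) =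
        distr N (count_space UNIV) (\<lambda>\<omega>. Inf {enat i | i. i \<ge> 1 \<and> B i \<omega>})) \<and>
     \<comment> \<open>(iii)\<close>
     (\<exists>!\<nu>. lamperti_generator M X \<nu>) \<and>
     (\<forall>\<nu>. lamperti_generator M X \<nu> \<longrightarrow>
        (\<forall>i\<ge>1. measure_pmf.prob \<nu> {..i} =
           1 - (1 - \<alpha> * (\<Sum>j=1..i. pochhammer (1 - \<alpha>) (j - 1) / fact j)) powr (1 / \<alpha>))) \<and>
     \<comment> \<open>(iv)\<close>
     (algebraic_tails M X \<alpha> \<and>
      (\<forall>\<nu>. lamperti_generator M X \<nu> \<longrightarrow> algebraic_tails (measure_pmf \<nu>) (\<lambda>k. k) 1)) \<and>
     \<comment> \<open>(v)\<close>
     (\<forall>\<nu>. lamperti_generator M X \<nu> \<longrightarrow>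
        (\<lambda>i. measure_pmf.prob \<nu> {i<..}) \<sim>[at_top]
        (\<lambda>i. 1 / Gamma (1 - \<alpha>) powr (1 / \<alpha>) * inverse (real i))) \<and>
     1 / Gamma (1 - \<alpha>) powr (1 / \<alpha>) < exp (- euler_mascheroni) \<and>
     (\<forall>\<nu>. lamperti_generator M X \<nu> \<longrightarrow>
        positive_recurrent (lamperti_kernel \<nu>) {1..} \<and>
        invariant_probability (lamperti_kernel \<nu>) {1..} (sibuya \<alpha>))"
proof -
  interpret sibuya_variable M X \<alpha>
    using assms by (intro sibuya_variable.intro sibuya_variable_axioms.intro)
  show ?thesis
    by (intro conjI allI impI pgf_eq completely_monotone_sibuya log_convex_sibuya alpha failure_rate
        infinitely_divisible_pred ex1_lamperti_generator lamperti_generator_cdf_sum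
        algebraic_tails_sibuya algebraic_tails_lamperti_generator lamperti_generator_tail_asymp
        Gamma_powr_bound lamperti_recurrent_invariant[OF alpha lamperti_generator_cdf])
      (assumption | elim conjE, rule distr_first_success; simp)+
qed

end
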